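(* The nonlinearized map $S_\beta:\mathbb R^{2N}\to\mathbb R^{2N}$, $(p,q)\mapsto(\breve p,\breve q)$, defined in the context is symplectic, i.e. $\sum_{j=1}^Nd\breve p_j\wedge d\breve q_j=\sum_{j=1}^Ndp_j\wedge dq_j$, and Liouville integrable, having the invariants $F_0,\dots,F_{N-1}$ defined in the context.
   Context: Let $A=\mathrm{diag}(\alpha_1,\dots,\alpha_N)$ with $\alpha_1^2,\dots,\alpha_N^2$ distinct nonzero constants, $\langle\cdot,\cdot\rangle$ the inner product on $\mathbb R^N$, $Q_\lambda(x,y)=\langle(\lambda^2-A^2)^{-1}x,y\rangle$, and $\beta$ a parameter. Coordinates on $\mathbb R^{2N}$ are $p=(p_1,\dots,p_N)^T$, $q=(q_1,\dots,q_N)^T$, and the Poisson bracket is $\{f,h\}=\sum_{s=1}^N\big(\frac{\partial f}{\partial q_s}\frac{\partial h}{\partial p_s}-\frac{\partial f}{\partial p_s}\frac{\partial h}{\partial q_s}\big)$. **Invariants.** Let $L^{11}(\lambda)=\frac{1+\langle p,q\rangle}2+Q_\lambda(A^2p,q)$, $L^{12}(\lambda)=-\lambda Q_\lambda(Ap,p)$, $L^{21}(\lambda)=\lambda Q_\lambda(Aq,q)$, and let $F(\lambda)=-(L^{11}(\lambda))^2-L^{12}(\lambda)L^{21}(\lambda)$ be the determinant of the traceless $2\times2$ matrix with these entries. For $|\lambda|>\max_j|\alpha_j|$ one has $F(\lambda)=\sum_{k\ge0}F_k\lambda^{-2k}$, with $F_0=-\frac{(1+\langle p,q\rangle)^2}4$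 and, for $k\ge1$, $$F_k=-(1+\langle p,q\rangle)\langle A^{2k}p,q\rangle-\sum_{\substack{i+j=k-2\\ i,j\ge0}}\langle A^{2i+2}p,q\rangle\langle A^{2j+2}p,q\rangle+\sum_{\substack{i+j=k-1\\ i,j\ge0}}\langle A^{2i+1}p,p\rangle\langle A^{2j+1}q,q\rangle .$$ **The map.** $S_\beta$ is given by $$\begin{pmatrix}\breve p_j\\ \breve q_j\end{pmatrix}=\frac1{\sqrt{\beta^2-\alpha_j^2}}\,\frac1{\sqrt\Upsilon}\begin{pmatrix}-\alpha_j^2+\beta^2+a\breve b&\alpha_ja\\ \alpha_j\breve b&\beta^2\end{pmatrix}\begin{pmatrix}p_j\\ q_j\end{pmatrix},\quad 1\le j\le N,\qquad \Upsilon=\beta^2+a\breve b,$$ where $a$ and $\breve b$ are subject to the constraints $$a=\frac{\langle Ap,p\rangle}{1+\langle p,q\rangle},\qquad \breve b=-\frac{\langle A\breve q,\breve q\rangle}{1+\langle p,q\rangle}.$$ By the first constraint and the definition of the map, the second constraint becomes the quadratic equation $$-\Big(\frac{\breve b}{\beta}\Big)^2L^{12}(\beta)+2\,\frac{\breve b}\beta\,L^{11}(\beta)+L^{21}(\beta)=0,$$ whose two roots correspond to the two signs of the square root $\sqrt{-F(\beta)}$; writing $F(\lambda)=-\frac{(1+\langle p,q\rangle)^2R(\lambda^2)}{4\alpha(\lambda^2)^2}$ with $\alpha(\zeta)=\prod_{j=1}^N(\zeta-\alpha_j^2)$ and $R(\zeta)$ a polynomial of degree $2N$, the root is single-valued as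 a function of the point over $\zeta=\beta^2$ on the curve $\xi^2=R(\zeta)$. With these constraints the map is nonlinear in $(p,q)$. **Liouville integrability** refers to $S_\beta$ being symplectic with the $N$ functions $F_0,\dots,F_{N-1}$ invariant, $F_k(\breve p,\breve q)=F_k(p,q)$, pairwise in involution, $\{F_j,F_k\}=0$, and functionally independent in the open set $\{dF_0\ne0\}$.
   Formalization: The map is taken on open sets where it is defined and real, with a continuous choice of root and F(β)≠0, β≠0, not on all of R^{2N}; functional independence means dF_0,…,dF_{N-1} independent on a dense subset of {dF_0≠0}, since it fails at p=0, q=e_1 for N≥2. *)

theory Defs
  imports "HOL-Analysis.Analysis"
begin

text \<open>
  A point of phase space is a pair \<open>(p, q)\<close>; the index type \<open>'n\<close> plays the role of
  \<open>{1..N}\<close>, so \<open>N = CARD('n)\<close>, and \<open>\<alpha> :: real ^ 'n\<close> is the diagonal of the matrix \<open>A\<close>.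
\<close>

type_synonym 'n phase = "(real ^ 'n) \<times> (real ^ 'n)"

text \<open>The vector \<open>A\<^sup>k x\<close>. (The power operation of the library type is not used, since on
  \<open>real ^ 'n ^ 'n\<close> it is not the matrix power.)\<close>

definition Apow :: "real ^ 'n \<Rightarrow> nat \<Rightarrow> real ^ 'n \<Rightarrow> real ^ 'n" where
  "Apow \<alpha> k x = (\<chi> j. (\<alpha> $ j) ^ k * x $ j)"

definition Qform :: "real ^ 'n \<Rightarrow> real \<Rightarrow> real ^ 'n \<Rightarrow> real ^ 'n \<Rightarrow> real" where
  "Qform \<alpha> l x y = (\<chi> j. x $ j / (l\<^sup>2 - (\<alpha> $ j)\<^sup>2)) \<bullet> y"


definition L11 :: "real ^ 'n \<Rightarrow> real \<Rightarrow> 'n phase \<Rightarrow> real" where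
  "L11 \<alpha> l x = (let p = fst x; q = snd x in (1 + p \<bullet> q) / 2 + Qform \<alpha> l (Apow \<alpha> 2 p) q)"

definition L12 :: "real ^ 'n \<Rightarrow> real \<Rightarrow> 'n phase \<Rightarrow> real" where
  "L12 \<alpha> l x = (let p = fst x in - l * Qform \<alpha> l (Apow \<alpha> 1 p) p)"

definition L21 :: "real ^ 'n \<Rightarrow> real \<Rightarrow> 'n phase \<Rightarrow> real" where
  "L21 \<alpha> l x = (let q = snd x in l * Qform \<alpha> l (Apow \<alpha> 1 q) q)"

definition detL :: "real ^ 'n \<Rightarrow> real \<Rightarrow> 'n phase \<Rightarrow> real" where
  "detL \<alpha> l x = - (L11 \<alpha> l x)\<^sup>2 - L12 \<alpha> l x * L21 \<alpha> l x"

text \<open>The coefficients of \<open>detL \<alpha> l x\<close> at \<open>l\<^sup>-\<^sup>2\<^sup>k\<close>. The index conditions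
  \<open>i + j = k - 2\<close> and \<open>i + j = k - 1\<close> are written without subtraction, so that the first sum
  is empty for \<open>k = 1\<close>.\<close>

definition Finv :: "real ^ 'n \<Rightarrow> nat \<Rightarrow> 'n phase \<Rightarrow> real" where
  "Finv \<alpha> k x = (let p = fst x; q = snd x in
     if k = 0 then - (1 + p \<bullet> q)\<^sup>2 / 4
     else - (1 + p \<bullet> q) * (Apow \<alpha> (2 * k) p \<bullet> q)
          - (\<Sum>(i, j) \<in> {(i, j). i + j + 2 = k}.
               (Apow \<alpha> (2 * i + 2) p \<bullet> q) * (Apow \<alpha> (2 * j + 2) p \<bullet> q))
          + (\<Sum>(i, j) \<in> {(i, j). i + j + 1 = k}.
               (Apow \<alpha> (2 * i + 1) p \<bullet> p) * (Apow \<alpha> (2 * j + 1) q \<bullet> q)))"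


definition a_coeff :: "real ^ 'n \<Rightarrow> 'n phase \<Rightarrow> real" where
  "a_coeff \<alpha> x = (let p = fst x; q = snd x in (Apow \<alpha> 1 p \<bullet> p) / (1 + p \<bullet> q))"

definition Upsilon :: "real ^ 'n \<Rightarrow> real \<Rightarrow> ('n phase \<Rightarrow> real) \<Rightarrow> 'n phase \<Rightarrow> real" where
  "Upsilon \<alpha> \<beta> b x = \<beta>\<^sup>2 + a_coeff \<alpha> x * b x"

text \<open>
  The map, with the first constraint already inserted and with the function \<open>b\<close> still to be
  subjected to the second one. The map is real when every \<open>\<beta>\<^sup>2 - \<alpha>\<^sub>j\<^sup>2\<close> has the same sign as
  \<open>\<Upsilon>\<close>. If these are all negative, the library convention \<open>sqrt (- t) = - sqrt t\<close> gives a
  positive prefactor, while imaginary principal roots give a negative one, that is,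
  the map composed with \<open>(p, q) \<mapsto> (- p, - q)\<close>.
\<close>

definition S_map :: "real ^ 'n \<Rightarrow> real \<Rightarrow> ('n phase \<Rightarrow> real) \<Rightarrow> 'n phase \<Rightarrow> 'n phase" where
  "S_map \<alpha> \<beta> b x = (let p = fst x; q = snd x; a = a_coeff \<alpha> x in
     (\<chi> j. 1 / sqrt (\<beta>\<^sup>2 - (\<alpha> $ j)\<^sup>2) * (1 / sqrt (Upsilon \<alpha> \<beta> b x)) *
            ((- (\<alpha> $ j)\<^sup>2 + \<beta>\<^sup>2 + a * b x) * p $ j + \<alpha> $ j * a * q $ j),
      \<chi> j. 1 / sqrt (\<beta>\<^sup>2 - (\<alpha> $ j)\<^sup>2) * (1 / sqrt (Upsilon \<alpha> \<beta> b x)) *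
            (\<alpha> $ j * b x * p $ j + \<beta>\<^sup>2 * q $ j)))"

text \<open>
  \<open>b\<close> is a single-valued choice on the open set \<open>U\<close> of the solution of the second constraint.
  The value \<open>b x\<close> is a root of a quadratic equation with discriminant \<open>- 4 * detL \<alpha> \<beta> x\<close>.
  Where \<open>detL \<alpha> \<beta> x \<noteq> 0\<close> a continuous choice of root is the same as a continuous choice of
  \<open>sqrt (- detL \<alpha> \<beta> x)\<close>, that is, of a point over \<open>\<beta>\<^sup>2\<close> on the spectral curve; both
  choices are covered, and no formula dividing by \<open>L12 \<alpha> \<beta> x\<close> is needed.
\<close>

definition breve_b_branch ::
  "real ^ 'n \<Rightarrow> real \<Rightarrow> 'n phase set \<Rightarrow> ('n phase \<Rightarrow> real) \<Rightarrow> bool" where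
  "breve_b_branch \<alpha> \<beta> U b \<longleftrightarrow>
     open U \<and> continuous_on U b \<and>
     (\<forall>x\<in>U. 1 + fst x \<bullet> snd x \<noteq> 0 \<and>
        (\<forall>j. (\<beta>\<^sup>2 - (\<alpha> $ j)\<^sup>2) * Upsilon \<alpha> \<beta> b x > 0) \<and>
        detL \<alpha> \<beta> x \<noteq> 0 \<and>
        b x = - (Apow \<alpha> 1 (snd (S_map \<alpha> \<beta> b x)) \<bullet> snd (S_map \<alpha> \<beta> b x))
                / (1 + fst x \<bullet> snd x))"


definition poisson :: "('n phase \<Rightarrow> real) \<Rightarrow> ('n phase \<Rightarrow> real) \<Rightarrow> 'n::finite phase \<Rightarrow> real" where
  "poisson f h x = (let df = frechet_derivative f (at x); dh = frechet_derivative h (at x) in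
     (\<Sum>s\<in>UNIV. df (0, axis s 1) * dh (axis s 1, 0) - df (axis s 1, 0) * dh (0, axis s 1)))"

text \<open>The value of \<open>\<Sum>\<^sub>j dp\<^sub>j \<and> dq\<^sub>j\<close> on a pair of tangent vectors.\<close>

definition omega :: "'n::finite phase \<Rightarrow> 'n phase \<Rightarrow> real" where
  "omega u v = (\<Sum>j\<in>UNIV. fst u $ j * snd v $ j - fst v $ j * snd u $ j)"

definition symplectic_on :: "'n::finite phase set \<Rightarrow> ('n phase \<Rightarrow> 'n phase) \<Rightarrow> bool" where
  "symplectic_on U S \<longleftrightarrow>
     (\<forall>x\<in>U. S differentiable (at x) \<and>
        (\<forall>u v. omega (frechet_derivative S (at x) u) (frechet_derivative S (at x) v) = omega u v))"

definition differentials_independent_at ::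
  "nat \<Rightarrow> (nat \<Rightarrow> 'n::finite phase \<Rightarrow> real) \<Rightarrow> 'n phase \<Rightarrow> bool" where
  "differentials_independent_at m F x \<longleftrightarrow>
     (\<forall>k<m. F k differentiable (at x)) \<and>
     (\<forall>c :: nat \<Rightarrow> real. (\<forall>v. (\<Sum>k<m. c k * frechet_derivative (F k) (at x) v) = 0)
        \<longrightarrow> (\<forall>k<m. c k = 0))"

text \<open>
  Functional independence: the differentials are linearly independent on a dense subset of \<open>W\<close>,
  that is, every nonempty open part of the open set \<open>W\<close> contains a point of independence.
  Independence at every point of \<open>W\<close> is a stronger notion, which fails for the invariants above
  on \<open>{dF\<^sub>0 \<noteq> 0}\<close> as soon as \<open>N \<ge> 2\<close> (take \<open>p = 0\<close> and \<open>q\<close> a coordinate vector).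
\<close>

definition functionally_independent_on ::
  "'n::finite phase set \<Rightarrow> nat \<Rightarrow> (nat \<Rightarrow> 'n phase \<Rightarrow> real) \<Rightarrow> bool" where
  "functionally_independent_on W m F \<longleftrightarrow>
     W \<subseteq> closure {x \<in> W. differentials_independent_at m F x}"

text \<open>Invariance is required where the map is defined, namely on \<open>U\<close>; involution and
  independence do not involve the map and are required on the whole phase space and on the
  whole of \<open>{dF\<^sub>0 \<noteq> 0}\<close>.\<close>

definition Liouville_integrable_on ::
  "'n::finite phase set \<Rightarrow> ('n phase \<Rightarrow> 'n phase) \<Rightarrow> (nat \<Rightarrow> 'n phase \<Rightarrow> real) \<Rightarrow> bool" where
  "Liouville_integrable_on U S F \<longleftrightarrow>
     symplectic_on U S \<and>
     (\<forall>k<CARD('n). \<forall>x\<in>U. F k (S x) = F k x) \<and>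
     (\<forall>j<CARD('n). \<forall>k<CARD('n). \<forall>x. poisson (F j) (F k) x = 0) \<and>
     functionally_independent_on {x. frechet_derivative (F 0) (at x) \<noteq> (\<lambda>v. 0)} CARD('n) F"

end

theory Submission
  imports Defs "HOL-Computational_Algebra.Formal_Power_Series"
begin

text \<open>
  With \<open>X = \<lambda>\<^sup>-\<^sup>2\<close>, the series \<open>\<Sum>\<^sub>k F\<^sub>k X\<^sup>k\<close> is the determinant of the Lax matrix over the ring of
  formal power series. The map intertwines the Lax matrices at the two points by the matrix
  \<open>((\<beta>\<^sup>2 + a b - \<lambda>\<^sup>2, \<lambda> a), (\<lambda> b, \<beta>\<^sup>2))\<close>; the residues agree because each block of the map is this matrix
  at \<open>\<lambda> = \<alpha>\<^sub>j\<close>, normalised to determinant one, and the two constraints on \<open>a\<close> and \<open>b\<close> take care of the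
  remaining polynomial part. Hence the determinants coincide. Involution is an identity in two
  variables \<open>X, Y\<close> after multiplication by \<open>X - Y\<close>. Independence is clear where \<open>q = 0\<close> and all
  \<open>p\<^sub>j \<noteq> 0\<close>, by Vandermonde, and spreads along the rays \<open>(p, t q)\<close>, since a determinant polynomial
  in \<open>t\<close> has finitely many zeros.

  For symplecticity, put \<open>\<kappa>\<^sub>j = sqrt ((\<beta>\<^sup>2 - \<alpha>\<^sub>j\<^sup>2) \<Upsilon>)\<close> and let \<open>P, Q\<close> be the image of \<open>p, q\<close>. Then
  \<open>\<beta>\<^sup>2 P = \<kappa> p + a A Q\<close> and \<open>\<beta>\<^sup>2 q = \<kappa> Q - b A p\<close>, and with \<open>d = 1 + p \<bullet> q\<close> the form
  \<open>\<beta>\<^sup>2 \<Sum> (dP \<and> dQ - dp \<and> dq)\<close> equals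
  \<open>\<Sum> d\<kappa>\<^sub>j \<and> d(p\<^sub>j Q\<^sub>j) + da \<and> d(A Q \<bullet> Q) / 2 - db \<and> d(A p \<bullet> p) / 2\<close>. By the constraints the first term is
  \<open>d\<Upsilon> \<and> dd / 2\<close> and the last two sum to \<open>- d(a b) \<and> dd / 2\<close>; they cancel.
\<close>

section \<open>The generating series of the invariants\<close>

notation fps_nth (infixl "$$" 75)

text \<open>The expansion of 1 / (1 - \<alpha>_s^2 X), that is, of \<lambda>^2 / (\<lambda>^2 -
  \<alpha>_s^2).\<close>

definition geom :: "real ^ 'n \<Rightarrow> 'n \<Rightarrow> real fps" where
  "geom \<alpha> s = Abs_fps (\<lambda>k. (\<alpha> $ s) ^ (2 * k))"

text \<open>The factor \<open>geom \<alpha> s - 1\<close> expands \<alpha>_s^2 / (\<lambda>^2 -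
  \<alpha>_s^2), the weight in Q_\<lambda>(A^2 p, q).\<close>

definition Mgen :: "real ^ 'n \<Rightarrow> 'n::finite phase \<Rightarrow> real fps" where
  "Mgen \<alpha> x = fps_const ((1 + fst x \<bullet> snd x) / 2)
     + (\<Sum>s\<in>UNIV. fps_const (fst x $ s * snd x $ s) * (geom \<alpha> s - 1))"

definition Qgen :: "real ^ 'n \<Rightarrow> real ^ 'n \<Rightarrow> real fps" where
  "Qgen \<alpha> y = (\<Sum>s\<in>UNIV. fps_const (\<alpha> $ s * (y $ s)\<^sup>2) * geom \<alpha> s)"

text \<open>In terms of these series \<open>L\<^sup>1\<^sup>1 = Mgen \<alpha> (p, q)\<close>, \<open>\<lambda> L\<^sup>1\<^sup>2 = - Qgen \<alpha> p\<close> and \<open>L\<^sup>2\<^sup>1 = \<lambda> X Qgen \<alpha> q\<close>.\<close>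

definition Fgen :: "real ^ 'n \<Rightarrow> 'n::finite phase \<Rightarrow> real fps" where
  "Fgen \<alpha> x = fps_X * Qgen \<alpha> (fst x) * Qgen \<alpha> (snd x) - Mgen \<alpha> x * Mgen \<alpha> x"

lemma geom_inverse: "(1 - fps_const ((\<alpha> $ s)\<^sup>2) * fps_X) * geom \<alpha> s = 1"
proof (rule fps_ext)
  fix n
  show "((1 - fps_const ((\<alpha> $ s)\<^sup>2) * fps_X) * geom \<alpha> s) $$ n = (1 :: real fps) $$ n"
    by (cases n) (simp_all add: geom_def left_diff_distrib mult.assoc power2_eq_square)
qed

lemma Mgen_nth:
  "Mgen \<alpha> x $$ k = (if k = 0 then (1 + fst x \<bullet> snd x) / 2 else Apow \<alpha> (2 * k) (fst x) \<bullet> snd x)"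
  by (simp add: Mgen_def fps_sum_nth geom_def Apow_def inner_vec_def ac_simps)

lemma Qgen_nth: "Qgen \<alpha> y $$ k = Apow \<alpha> (2 * k + 1) y \<bullet> y"
  by (simp add: Qgen_def fps_sum_nth geom_def Apow_def inner_vec_def power2_eq_square ac_simps)

text \<open>Brings the Cauchy product into the shape of the index sets in
  \<open>Finv\<close>.\<close>

lemma fps_mult_nth_pairs:
  "(f * g) $$ n = (\<Sum>(i, j) \<in> {(i, j). i + j = n}. f $$ i * g $$ j)"
  unfolding fps_mult_nth
  by (rule sum.reindex_bij_witness[where i = fst and j = "\<lambda>i. (i, n - i)"]) auto

text \<open>With the constant term d / 2 of \<open>Mgen\<close> split off, the cross term of its
  square yields the moment of order 2k, and the square of the tail starts at X^2. The product of the
  two \<open>Qgen\<close> carries a single X. This accounts for the totals k - 2 and k - 1 in the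
  two sums.\<close>

lemma Fgen_nth: "Fgen \<alpha> x $$ k = Finv \<alpha> k x"
proof (cases k)
  case 0
  then show ?thesis
    by (simp add: Fgen_def Finv_def Let_def Mgen_nth power2_eq_square)
next
  case (Suc n)
  define d where "d = 1 + fst x \<bullet> snd x"
  define V where "V = Abs_fps (\<lambda>k. Apow \<alpha> (2 * k + 2) (fst x) \<bullet> snd x)"
  have M: "Mgen \<alpha> x = fps_const (d / 2) + fps_X * V"
  proof (rule fps_ext)
    fix m show "Mgen \<alpha> x $$ m = (fps_const (d / 2) + fps_X * V) $$ m"
      by (cases m) (simp_all add: Mgen_nth V_def d_def)
  qed
  have MM: "Mgen \<alpha> x * Mgen \<alpha> x = fps_const (d\<^sup>2 / 4) + fps_X * (fps_const d * V + fps_X * (V * V))"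
  proof -
    have "Mgen \<alpha> x * Mgen \<alpha> x = fps_const (d / 2) * fps_const (d / 2) + fps_X * ((fps_const (d / 2) + fps_const (d / 2)) * V + fps_X * (V * V))"
      unfolding M by (simp only: algebra_simps)
    then show ?thesis by (simp add: power2_eq_square)
  qed
  have Fk: "Fgen \<alpha> x $$ k = (Qgen \<alpha> (fst x) * Qgen \<alpha> (snd x)) $$ n - d * V $$ n - (fps_X * (V * V)) $$ n"
    unfolding Fgen_def MM Suc by (simp add: mult.assoc)
  have "(fps_X * (V * V)) $$ n = (\<Sum>(i, j) \<in> {(i, j). i + j + 2 = k}.
               (Apow \<alpha> (2 * i + 2) (fst x) \<bullet> snd x) * (Apow \<alpha> (2 * j + 2) (fst x) \<bullet> snd x))"
  proof (cases n)
    case 0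
    have "{(i, j). i + j + 2 = k} = {}" unfolding Suc 0 by auto
    then show ?thesis by (simp add: 0)
  next
    case (Suc m)
    have "(fps_X * (V * V)) $$ n = (V * V) $$ m" by (simp add: Suc)
    then show ?thesis using \<open>k = Suc n\<close> Suc by (simp add: fps_mult_nth_pairs V_def)
  qed
  moreover have "(Qgen \<alpha> (fst x) * Qgen \<alpha> (snd x)) $$ n = (\<Sum>(i, j) \<in> {(i, j). i + j + 1 = k}.
               (Apow \<alpha> (2 * i + 1) (fst x) \<bullet> fst x) * (Apow \<alpha> (2 * j + 1) (snd x) \<bullet> snd x))"
    unfolding Suc by (simp add: fps_mult_nth_pairs Qgen_nth)
  ultimately show ?thesis
    unfolding Fk using Suc by (simp add: Finv_def Let_def V_def d_def algebra_simps)
qed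

section \<open>Coefficientwise differentiation of series depending on a point\<close>

definition fps_has_derivative ::
    "('a::real_normed_vector \<Rightarrow> real fps) \<Rightarrow> ('a \<Rightarrow> real fps) \<Rightarrow> 'a \<Rightarrow> bool" where
  "fps_has_derivative f f' x \<longleftrightarrow> (\<forall>k. ((\<lambda>y. f y $$ k) has_derivative (\<lambda>v. f' v $$ k)) (at x))"

lemma fps_has_derivative_const: "fps_has_derivative (\<lambda>y. c) (\<lambda>v. 0) x"
  by (simp add: fps_has_derivative_def)

lemma fps_has_derivative_fps_const:
  assumes "(f has_derivative f') (at x)"
  shows "fps_has_derivative (\<lambda>y. fps_const (f y)) (\<lambda>v. fps_const (f' v)) x"
  unfolding fps_has_derivative_def
proof
  fix k show "((\<lambda>y. fps_const (f y) $$ k) has_derivative (\<lambda>v. fps_const (f' v) $$ k)) (at x)"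
    using assms by (cases "k = 0") simp_all
qed

lemma fps_has_derivative_add:
  assumes "fps_has_derivative f f' x" "fps_has_derivative g g' x"
  shows "fps_has_derivative (\<lambda>y. f y + g y) (\<lambda>v. f' v + g' v) x"
  using assms by (simp add: fps_has_derivative_def has_derivative_add)

lemma fps_has_derivative_diff:
  assumes "fps_has_derivative f f' x" "fps_has_derivative g g' x"
  shows "fps_has_derivative (\<lambda>y. f y - g y) (\<lambda>v. f' v - g' v) x"
  using assms by (simp add: fps_has_derivative_def has_derivative_diff)

lemma fps_has_derivative_sum:
  assumes "\<And>i. i \<in> I \<Longrightarrow> fps_has_derivative (f i) (f' i) x"
  shows "fps_has_derivative (\<lambda>y. \<Sum>i\<in>I. f i y) (\<lambda>v. \<Sum>i\<in>I. f' i v) x"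
  using assms by (simp add: fps_has_derivative_def fps_sum_nth has_derivative_sum)

lemma fps_has_derivative_mult:
  assumes "fps_has_derivative f f' x" "fps_has_derivative g g' x"
  shows "fps_has_derivative (\<lambda>y. f y * g y) (\<lambda>v. f x * g' v + f' v * g x) x"
  unfolding fps_has_derivative_def
proof
  fix k
  have "((\<lambda>y. \<Sum>i=0..k. f y $$ i * g y $$ (k - i)) has_derivative
      (\<lambda>v. \<Sum>i=0..k. f x $$ i * g' v $$ (k - i) + f' v $$ i * g x $$ (k - i))) (at x)"
    using assms unfolding fps_has_derivative_def
    by (intro has_derivative_sum has_derivative_mult) auto
  then show "((\<lambda>y. (f y * g y) $$ k) has_derivative (\<lambda>v. (f x * g' v + f' v * g x) $$ k)) (at x)"
    by (simp add: fps_mult_nth sum.distrib)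
qed

definition dMgen :: "real ^ 'n \<Rightarrow> 'n::finite phase \<Rightarrow> 'n phase \<Rightarrow> real fps" where
  "dMgen \<alpha> x v = fps_const ((fst x \<bullet> snd v + fst v \<bullet> snd x) / 2)
     + (\<Sum>s\<in>UNIV. fps_const (fst x $ s * snd v $ s + fst v $ s * snd x $ s) * (geom \<alpha> s - 1))"

definition dQgen :: "real ^ 'n \<Rightarrow> real ^ 'n \<Rightarrow> real ^ 'n \<Rightarrow> real fps" where
  "dQgen \<alpha> y v = (\<Sum>s\<in>UNIV. fps_const (2 * \<alpha> $ s * y $ s * v $ s) * geom \<alpha> s)"

definition dFgen :: "real ^ 'n \<Rightarrow> 'n::finite phase \<Rightarrow> 'n phase \<Rightarrow> real fps" where
  "dFgen \<alpha> x v = fps_X * (Qgen \<alpha> (fst x) * dQgen \<alpha> (snd x) (snd v)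
       + dQgen \<alpha> (fst x) (fst v) * Qgen \<alpha> (snd x)) - 2 * Mgen \<alpha> x * dMgen \<alpha> x v"

lemma Mgen_has_derivative: "fps_has_derivative (Mgen \<alpha>) (dMgen \<alpha> x) x"
proof -
  have "fps_has_derivative (\<lambda>x. fps_const ((1 + fst x \<bullet> snd x) / 2)
      + (\<Sum>s\<in>UNIV. fps_const (fst x $ s * snd x $ s) * (geom \<alpha> s - 1)))
    (\<lambda>v. fps_const ((fst x \<bullet> snd v + fst v \<bullet> snd x) / 2)
      + (\<Sum>s\<in>UNIV. fps_const (fst x $ s * snd x $ s) * 0
         + fps_const (fst x $ s * snd v $ s + fst v $ s * snd x $ s) * (geom \<alpha> s - 1))) x"
    by (intro fps_has_derivative_add fps_has_derivative_sum fps_has_derivative_mult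
        fps_has_derivative_const fps_has_derivative_fps_const)
      (auto intro!: derivative_eq_intros bounded_linear.has_derivative[OF bounded_linear_vec_nth])
  then show ?thesis by (simp add: Mgen_def[abs_def] dMgen_def[abs_def])
qed

lemma Qgen_has_derivative:
  assumes "(f has_derivative f') (at x)"
  shows "fps_has_derivative (\<lambda>y. Qgen \<alpha> (f y)) (\<lambda>v. dQgen \<alpha> (f x) (f' v)) x"
proof -
  have "((\<lambda>y. f y $ s) has_derivative (\<lambda>v. f' v $ s)) (at x)" for s
    using assms by (rule bounded_linear.has_derivative[OF bounded_linear_vec_nth])
  then have "fps_has_derivative (\<lambda>y. \<Sum>s\<in>UNIV. fps_const (\<alpha> $ s * (f y $ s)\<^sup>2) * geom \<alpha> s)
    (\<lambda>v. \<Sum>s\<in>UNIV. fps_const (\<alpha> $ s * (f x $ s)\<^sup>2) * 0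
         + fps_const (2 * \<alpha> $ s * f x $ s * f' v $ s) * geom \<alpha> s) x"
    by (intro fps_has_derivative_sum fps_has_derivative_mult
        fps_has_derivative_const fps_has_derivative_fps_const)
      (auto intro!: derivative_eq_intros)
  then show ?thesis by (simp add: Qgen_def[abs_def] dQgen_def[abs_def])
qed

lemma Fgen_has_derivative: "fps_has_derivative (Fgen \<alpha>) (dFgen \<alpha> x) x"
proof -
  have "fps_has_derivative (\<lambda>x. fps_X * (Qgen \<alpha> (fst x) * Qgen \<alpha> (snd x)) - Mgen \<alpha> x * Mgen \<alpha> x)
     (\<lambda>v. fps_X * (Qgen \<alpha> (fst x) * dQgen \<alpha> (snd x) (snd v) + dQgen \<alpha> (fst x) (fst v) * Qgen \<alpha> (snd x))
        + 0 * (Qgen \<alpha> (fst x) * Qgen \<alpha> (snd x))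
        - (Mgen \<alpha> x * dMgen \<alpha> x v + dMgen \<alpha> x v * Mgen \<alpha> x)) x"
    by (intro fps_has_derivative_diff fps_has_derivative_mult fps_has_derivative_const
        Qgen_has_derivative Mgen_has_derivative has_derivative_fst has_derivative_snd has_derivative_ident)
  moreover have "Fgen \<alpha> = (\<lambda>x. fps_X * (Qgen \<alpha> (fst x) * Qgen \<alpha> (snd x)) - Mgen \<alpha> x * Mgen \<alpha> x)"
    by (simp add: Fgen_def fun_eq_iff mult.assoc)
  moreover have "dFgen \<alpha> x = (\<lambda>v. fps_X * (Qgen \<alpha> (fst x) * dQgen \<alpha> (snd x) (snd v) + dQgen \<alpha> (fst x) (fst v) * Qgen \<alpha> (snd x))
        + 0 * (Qgen \<alpha> (fst x) * Qgen \<alpha> (snd x))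
        - (Mgen \<alpha> x * dMgen \<alpha> x v + dMgen \<alpha> x v * Mgen \<alpha> x))"
    by (simp add: dFgen_def fun_eq_iff algebra_simps)
  ultimately show ?thesis by simp
qed

lemma Finv_has_derivative: "(Finv \<alpha> k has_derivative (\<lambda>v. dFgen \<alpha> x v $$ k)) (at x)"
  using Fgen_has_derivative[of \<alpha> x] unfolding fps_has_derivative_def Fgen_nth by blast

lemma frechet_derivative_Finv: "frechet_derivative (Finv \<alpha> k) (at x) = (\<lambda>v. dFgen \<alpha> x v $$ k)"
  using frechet_derivative_at[OF Finv_has_derivative] by (rule sym)

text \<open>Evaluates the sums in \<open>dMgen\<close> and \<open>dQgen\<close> on a coordinate
  direction, where only the summand at \<open>s\<close> survives.\<close>

lemma sum_axis:
  fixes f :: "'n::finite \<Rightarrow> real \<Rightarrow> 'a::comm_monoid_add"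
  assumes "\<And>i. f i 0 = 0"
  shows "(\<Sum>i\<in>UNIV. f i (axis s 1 $ i)) = f s 1"
proof -
  have "(\<Sum>i\<in>UNIV. f i (axis s 1 $ i)) = (\<Sum>i\<in>UNIV. if i = s then f s 1 else 0)"
    using assms by (intro sum.cong) (auto simp: axis_def)
  then show ?thesis by simp
qed

text \<open>The 1/2 is what remains when the derivative of the leading term (1 + p.q) / 2 joins the
  one carrying \<open>geom \<alpha> s - 1\<close>.\<close>

lemma dFgen_q_axis:
  "dFgen \<alpha> x (0, axis s 1) = 2 * (fps_X * Qgen \<alpha> (fst x) * fps_const (\<alpha> $ s * snd x $ s) * geom \<alpha> s
     - Mgen \<alpha> x * fps_const (fst x $ s) * (geom \<alpha> s - fps_const (1/2)))"
proof -
  have 1: "dMgen \<alpha> x (0, axis s 1) = fps_const (fst x $ s / 2) + fps_const (fst x $ s) * (geom \<alpha> s - 1)"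
    using sum_axis[of "\<lambda>i t. fps_const (fst x $ i * t) * (geom \<alpha> i - 1)" s]
    by (simp add: dMgen_def inner_axis)
  have 2: "dQgen \<alpha> (snd x) (axis s 1) = 2 * (fps_const (\<alpha> $ s * snd x $ s) * geom \<alpha> s)"
    using sum_axis[of "\<lambda>i t. fps_const (2 * \<alpha> $ i * snd x $ i * t) * geom \<alpha> i" s]
    by (simp add: dQgen_def fps_numeral_fps_const mult.assoc flip: fps_const_mult)
  have 3: "dMgen \<alpha> x (0, axis s 1) = fps_const (fst x $ s) * (geom \<alpha> s - fps_const (1/2))"
    unfolding 1 by (rule fps_ext) (simp add: algebra_simps)
  have "dQgen \<alpha> (fst x) 0 = 0" by (simp add: dQgen_def)
  then show ?thesis by (simp add: dFgen_def 2 3 algebra_simps)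
qed

lemma dFgen_p_axis:
  "dFgen \<alpha> x (axis s 1, 0) = 2 * (fps_X * Qgen \<alpha> (snd x) * fps_const (\<alpha> $ s * fst x $ s) * geom \<alpha> s
     - Mgen \<alpha> x * fps_const (snd x $ s) * (geom \<alpha> s - fps_const (1/2)))"
proof -
  have 1: "dMgen \<alpha> x (axis s 1, 0) = fps_const (snd x $ s / 2) + fps_const (snd x $ s) * (geom \<alpha> s - 1)"
    using sum_axis[of "\<lambda>i t. fps_const (t * snd x $ i) * (geom \<alpha> i - 1)" s]
    by (simp add: dMgen_def inner_axis')
  have 2: "dQgen \<alpha> (fst x) (axis s 1) = 2 * (fps_const (\<alpha> $ s * fst x $ s) * geom \<alpha> s)"
    using sum_axis[of "\<lambda>i t. fps_const (2 * \<alpha> $ i * fst x $ i * t) * geom \<alpha> i" s]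
    by (simp add: dQgen_def fps_numeral_fps_const mult.assoc flip: fps_const_mult)
  have 3: "dMgen \<alpha> x (axis s 1, 0) = fps_const (snd x $ s) * (geom \<alpha> s - fps_const (1/2))"
    unfolding 1 by (rule fps_ext) (simp add: algebra_simps)
  have "dQgen \<alpha> (snd x) 0 = 0" by (simp add: dQgen_def)
  then show ?thesis by (simp add: dFgen_def 2 3 algebra_simps)
qed

section \<open>Involution\<close>

text \<open>After multiplication by X - Y, each product of the resolvents \<open>g s\<close> and
  \<open>h s\<close> becomes a difference of single ones. The sums over \<open>s\<close> are then
  again M, U, W at X or Y, and the remaining polynomial vanishes identically.\<close>

lemma involution_identity:
  fixes g h :: "'n \<Rightarrow> 'a::idom" and \<alpha> p q :: "'n \<Rightarrow> 'a"
  assumes g: "\<And>s. (1 - \<alpha> s * \<alpha> s * X) * g s = 1"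
    and h: "\<And>s. (1 - \<alpha> s * \<alpha> s * Y) * h s = 1"
    and XY: "X \<noteq> Y"
    and M: "M = m + (\<Sum>s\<in>I. p s * q s * g s)" "M' = m + (\<Sum>s\<in>I. p s * q s * h s)"
    and U: "U = (\<Sum>s\<in>I. \<alpha> s * (p s * p s) * g s)" "U' = (\<Sum>s\<in>I. \<alpha> s * (p s * p s) * h s)"
    and W: "W = (\<Sum>s\<in>I. \<alpha> s * (q s * q s) * g s)" "W' = (\<Sum>s\<in>I. \<alpha> s * (q s * q s) * h s)"
  shows "(\<Sum>s\<in>I. (X * U * (\<alpha> s * q s) * g s - M * p s * (g s - c))
             * (Y * W' * (\<alpha> s * p s) * h s - M' * q s * (h s - c))
           - (X * W * (\<alpha> s * p s) * g s - M * q s * (g s - c))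
             * (Y * U' * (\<alpha> s * q s) * h s - M' * p s * (h s - c))) = 0" (is "?S = 0")
proof -
  define T where "T = X - Y"
  \<comment> \<open>Resolvent identities, here and in \<open>gh2\<close> with the weight \<alpha>^2;
    they come from inserting 1 = (1 - \<alpha>^2 Y) h and 1 = (1 - \<alpha>^2 X) g.\<close>
  have gh1: "T * (g s * h s) = X * g s - Y * h s" for s
  proof -
    have "X * g s * ((1 - \<alpha> s * \<alpha> s * Y) * h s) - Y * h s * ((1 - \<alpha> s * \<alpha> s * X) * g s) = T * (g s * h s)"
      by (simp add: T_def algebra_simps)
    then show ?thesis by (simp add: g h)
  qed
  have gh2: "T * (\<alpha> s * \<alpha> s * (g s * h s)) = g s - h s" for s
  proof -
    have "g s * ((1 - \<alpha> s * \<alpha> s * Y) * h s) - h s * ((1 - \<alpha> s * \<alpha> s * X) * g s) = T * (\<alpha> s * \<alpha> s * (g s * h s))"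
      by (simp add: T_def algebra_simps)
    then show ?thesis by (simp add: g h)
  qed
  \<comment> \<open>The terms with M * M' cancel within each summand; the rest becomes linear in the
    resolvents at \<open>s\<close>.\<close>
  have term_eq: "T * ((X * U * (\<alpha> s * q s) * g s - M * p s * (g s - c))
             * (Y * W' * (\<alpha> s * p s) * h s - M' * q s * (h s - c))
           - (X * W * (\<alpha> s * p s) * g s - M * q s * (g s - c))
             * (Y * U' * (\<alpha> s * q s) * h s - M' * p s * (h s - c)))
      = X * Y * (U * W' - W * U') * (p s * q s * (g s - h s))
        + M * Y * (U' * (\<alpha> s * (q s * q s) * (X * g s - Y * h s - c * T * h s))
                   - W' * (\<alpha> s * (p s * p s) * (X * g s - Y * h s - c * T * h s)))
        + X * M' * (W * (\<alpha> s * (p s * p s) * (X * g s - Y * h s - c * T * g s))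
                    - U * (\<alpha> s * (q s * q s) * (X * g s - Y * h s - c * T * g s)))" for s
    unfolding gh1[symmetric] gh2[symmetric] by (simp add: algebra_simps)
  have sums:
    "(\<Sum>s\<in>I. p s * q s * (g s - h s)) = M - M'"
    "(\<Sum>s\<in>I. \<alpha> s * (p s * p s) * (X * g s - Y * h s - c * T * h s)) = X * U - Y * U' - c * T * U'"
    "(\<Sum>s\<in>I. \<alpha> s * (p s * p s) * (X * g s - Y * h s - c * T * g s)) = X * U - Y * U' - c * T * U"
    "(\<Sum>s\<in>I. \<alpha> s * (q s * q s) * (X * g s - Y * h s - c * T * h s)) = X * W - Y * W' - c * T * W'"
    "(\<Sum>s\<in>I. \<alpha> s * (q s * q s) * (X * g s - Y * h s - c * T * g s)) = X * W - Y * W' - c * T * W"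
    unfolding M U W
    by (simp_all add: sum_distrib_left sum_subtractf right_diff_distrib mult.left_commute mult.assoc mult.commute)
  have "T * ?S = X * Y * (U * W' - W * U') * (M - M')
        + M * Y * (U' * (X * W - Y * W' - c * T * W') - W' * (X * U - Y * U' - c * T * U'))
        + X * M' * (W * (X * U - Y * U' - c * T * U) - U * (X * W - Y * W' - c * T * W))"
    unfolding sums[symmetric] sum_distrib_left term_eq
    by (simp only: sum_distrib_left sum.distrib sum_subtractf right_diff_distrib)
  also have "\<dots> = 0" by (simp add: algebra_simps)
  finally show ?thesis using XY by (simp add: T_def)
qed

text \<open>In the ring of series in \<open>Y\<close> over the series in \<open>X\<close>, \<open>fps_const f\<close> is \<open>f(X)\<close> and
  \<open>fps_outer f\<close> is \<open>f(Y)\<close>.\<close>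

definition fps_outer :: "'a::comm_ring_1 fps \<Rightarrow> 'a fps fps" where
  "fps_outer f = Abs_fps (\<lambda>k. fps_const (f $$ k))"

lemma fps_outer_nth [simp]: "fps_outer f $$ k = fps_const (f $$ k)"
  by (simp add: fps_outer_def)

lemma fps_outer_add: "fps_outer (f + g) = fps_outer f + fps_outer g"
  by (rule fps_ext) simp

lemma fps_outer_diff: "fps_outer (f - g) = fps_outer f - fps_outer g"
  by (rule fps_ext) simp

lemma fps_outer_const: "fps_outer (fps_const c) = fps_const (fps_const c)"
  by (rule fps_ext) simp

lemma fps_outer_X: "fps_outer fps_X = fps_X"
  by (rule fps_ext) (simp add: fps_X_def)

lemma fps_outer_1: "fps_outer 1 = 1"
  by (rule fps_ext) simp

lemma fps_const_sum: "fps_const (\<Sum>i\<in>I. f i) = (\<Sum>i\<in>I. fps_const (f i))"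
  by (induction I rule: infinite_finite_induct) (simp_all flip: fps_const_add)

lemma fps_outer_sum: "fps_outer (\<Sum>i\<in>I. f i) = (\<Sum>i\<in>I. fps_outer (f i))"
  by (rule fps_ext) (simp add: fps_sum_nth fps_const_sum)

lemma fps_outer_mult: "fps_outer (f * g) = fps_outer f * fps_outer g"
  by (rule fps_ext) (simp add: fps_mult_nth fps_const_sum)

lemmas fps_outer_simps = fps_outer_add fps_outer_diff fps_outer_const fps_outer_X fps_outer_1
  fps_outer_sum fps_outer_mult

text \<open>The coefficient of X^j Y^k in f(X) g(Y): the outer index belongs to Y, the inner one to
  X.\<close>

lemma const_times_outer_nth: "(fps_const f * fps_outer g) $$ k $$ j = f $$ j * g $$ k"
  by simp

text \<open>Up to the factor 4, the bracket of F_j and F_k is the coefficient of X^j Y^k in the sum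
  treated by \<open>involution_identity\<close>; one identity in two variables covers all pairs of
  indices.\<close>

lemma poisson_Finv: "poisson (Finv \<alpha> j) (Finv \<alpha> k) x = 0"
proof -
  define e where "e = (\<lambda>c::real. fps_const (fps_const c))"
  define h where "h = (1 / 2 :: real)"
  define dp where "dp s = fps_X * Qgen \<alpha> (snd x) * fps_const (\<alpha> $ s * fst x $ s) * geom \<alpha> s
     - Mgen \<alpha> x * fps_const (snd x $ s) * (geom \<alpha> s - fps_const h)" for s
  define dq where "dq s = fps_X * Qgen \<alpha> (fst x) * fps_const (\<alpha> $ s * snd x $ s) * geom \<alpha> s
     - Mgen \<alpha> x * fps_const (fst x $ s) * (geom \<alpha> s - fps_const h)" for s
  \<comment> \<open>The constant left in \<open>Mgen\<close> once \<open>geom \<alpha> s - 1\<close>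
    is replaced by \<open>geom \<alpha> s\<close>.\<close>
  define m where "m = (1 + fst x \<bullet> snd x) / 2 - fst x \<bullet> snd x"
  have M: "Mgen \<alpha> x = fps_const m + (\<Sum>s\<in>UNIV. fps_const (fst x $ s) * fps_const (snd x $ s) * geom \<alpha> s)"
    by (simp add: Mgen_def m_def right_diff_distrib sum_subtractf inner_vec_def flip: fps_const_sum)
  have Q: "Qgen \<alpha> y = (\<Sum>s\<in>UNIV. fps_const (\<alpha> $ s) * (fps_const (y $ s) * fps_const (y $ s)) * geom \<alpha> s)" for y
    by (simp add: Qgen_def power2_eq_square)
  have hom1: "fps_const (f + g) = fps_const f + fps_const g" "fps_const (f * g) = fps_const f * fps_const g"
    "fps_const (f - g) = fps_const f - fps_const g" for f g :: "real fps" by simp_all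
  have g1: "(1 - fps_const (\<alpha> $ s) * fps_const (\<alpha> $ s) * fps_X) * geom \<alpha> s = 1" for s
    using geom_inverse[of \<alpha> s] by (simp add: power2_eq_square)
  have "(\<Sum>s\<in>UNIV. fps_const (dq s) * fps_outer (dp s) - fps_const (dp s) * fps_outer (dq s)) = 0"
    unfolding dp_def dq_def hom1 fps_outer_simps fps_const_mult[symmetric, where 'a = real]
    apply (rule involution_identity[where m = "e m"])
    subgoal for s using arg_cong[OF g1[of s], of fps_const] unfolding hom1 by simp
    subgoal for s using arg_cong[OF g1[of s], of fps_outer] unfolding fps_outer_simps by simp
    \<comment> \<open>X and Y differ as series in Y: their coefficients at Y^0 are X and 0.\<close>
    subgoal by (auto simp: fps_eq_iff intro!: exI[of _ 0])
    subgoal unfolding M hom1 fps_const_sum e_def ..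
    subgoal unfolding M fps_outer_simps e_def ..
    subgoal unfolding Q hom1 fps_const_sum ..
    subgoal unfolding Q fps_outer_simps ..
    subgoal unfolding Q hom1 fps_const_sum ..
    subgoal unfolding Q fps_outer_simps ..
    done
  from arg_cong[OF this, of "\<lambda>f. f $$ k $$ j"]
  have 0: "(\<Sum>s\<in>UNIV. dq s $$ j * dp s $$ k - dp s $$ j * dq s $$ k) = 0"
    by (simp add: fps_sum_nth const_times_outer_nth)
  have "dFgen \<alpha> x (0, axis s 1) = fps_const 2 * dq s" "dFgen \<alpha> x (axis s 1, 0) = fps_const 2 * dp s" for s
    by (simp_all add: dFgen_q_axis dFgen_p_axis dq_def dp_def h_def fps_numeral_fps_const)
  then have "poisson (Finv \<alpha> j) (Finv \<alpha> k) x = 4 * (\<Sum>s\<in>UNIV. dq s $$ j * dp s $$ k - dp s $$ j * dq s $$ k)"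
    by (simp add: poisson_def frechet_derivative_Finv Let_def sum_distrib_left algebra_simps)
  then show ?thesis by (simp add: 0)
qed

section \<open>Functional independence\<close>

text \<open>By the Leibniz formula the determinant is a polynomial in t, and its value at t = 0 is
  nonzero.\<close>

lemma finite_roots_det_affine:
  fixes A B :: "real ^ 'n ^ 'n"
  assumes "det A \<noteq> 0"
  shows "finite {t. det (A + t *\<^sub>R B) = 0}"
proof -
  define P where "P = (\<Sum>\<pi> | \<pi> permutes (UNIV :: 'n set).
    of_int (sign \<pi>) * (\<Prod>i\<in>UNIV. [:A $ i $ \<pi> i, B $ i $ \<pi> i:]))"
  have P: "poly P t = det (A + t *\<^sub>R B)" for t
    by (simp add: P_def det_def poly_sum poly_prod of_int_poly)
  have "P \<noteq> 0" using P[of 0] assms by auto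
  then show ?thesis using poly_roots_finite[of P] by (simp add: P)
qed

text \<open>A polynomial of degree below N with N distinct roots is zero.\<close>

lemma vandermonde_kernel:
  fixes z :: "'n::finite \<Rightarrow> real"
  assumes "inj z" and "\<And>s. (\<Sum>k<CARD('n). c k * z s ^ k) = 0" and "k < CARD('n)"
  shows "c k = 0"
proof -
  define P where "P = (\<Sum>k<CARD('n). monom (c k) k)"
  have coeff: "coeff P k = (if k < CARD('n) then c k else 0)" for k
    by (simp add: P_def coeff_sum)
  have root: "poly P (z s) = 0" for s
    using assms(2)[of s] by (simp add: P_def poly_sum poly_monom)
  have "P = 0"
  proof (rule ccontr)
    assume P: "P \<noteq> 0"
    have "CARD('n) = card (range z)" using assms(1) by (simp add: card_image)
    also have "\<dots> \<le> card {x. poly P x = 0}"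
      using root by (intro card_mono poly_roots_finite P) auto
    also have "\<dots> \<le> degree P" by (rule card_poly_roots_bound[OF P])
    also have "degree P < CARD('n)"
      using P coeff by (metis leading_coeff_0_iff)
    finally show False by simp
  qed
  then show ?thesis using coeff[of k] assms(3) by simp
qed

text \<open>The bijection \<open>f\<close> translates between invariants numbered by k < N and
  matrix columns indexed by the type \<open>'n\<close>; the next lemma is the opposite
  direction.\<close>

lemma kernel_trivial_if_det:
  fixes A :: "real ^ 'n ^ 'n" and f :: "'n \<Rightarrow> nat"
  assumes "det A \<noteq> 0" and f: "bij_betw f UNIV {..<CARD('n)}"
    and "\<And>s i. A $ s $ i = a s (f i)"
    and 0: "\<And>s. (\<Sum>k<CARD('n). c k * a s k) = 0" and "k < CARD('n)"
  shows "c k = 0"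
proof -
  have "A *v (\<chi> i. c (f i)) = 0"
  proof -
    have "(\<Sum>i\<in>UNIV. a s (f i) * c (f i)) = 0" for s
      using 0[of s] sum.reindex_bij_betw[OF f, of "\<lambda>k. a s k * c k"] by (simp add: mult.commute)
    then show ?thesis by (simp add: vec_eq_iff matrix_vector_mult_def assms(3))
  qed
  moreover have "invertible A" using assms(1) by (simp add: invertible_det_nz)
  ultimately have "(\<chi> i. c (f i)) = 0"
    using inj_matrix_vector_mult[of A] by (metis injD matrix_vector_mult_0_right)
  then have "c (f i) = 0" for i by (simp add: vec_eq_iff)
  then show ?thesis using f assms(5) by (metis bij_betw_iff_bijections lessThan_iff)
qed

lemma det_nonzero_if_kernel_trivial:
  fixes A :: "real ^ 'n ^ 'n"
  assumes f: "bij_betw f UNIV {..<CARD('n)}"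
    and A: "\<And>s i. A $ s $ i = a s (f i)"
    and "\<And>c. (\<And>s. (\<Sum>k<CARD('n). c k * a s k) = 0) \<Longrightarrow> (\<forall>k<CARD('n). c k = 0)"
  shows "det A \<noteq> 0"
proof -
  have "v = 0" if "A *v v = 0" for v
  proof -
    define c where "c k = v $ (the_inv f k)" for k
    have inj: "inj f" using f by (rule bij_betw_imp_inj_on)
    then have cf: "c (f i) = v $ i" for i by (simp add: c_def the_inv_f_f)
    have "(\<Sum>k<CARD('n). c k * a s k) = 0" for s
    proof -
      have "(\<Sum>i\<in>UNIV. a s (f i) * v $ i) = 0"
        using that by (simp add: vec_eq_iff matrix_vector_mult_def A)
      then show ?thesis
        using sum.reindex_bij_betw[OF f, of "\<lambda>k. c k * a s k"] by (simp add: cf mult.commute)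
    qed
    then have "\<forall>k<CARD('n). c k = 0" by (rule assms(3))
    moreover have "f i < CARD('n)" for i using bij_betw_apply[OF f, of i] by simp
    ultimately show ?thesis using cf by (metis vec_eq_iff zero_index)
  qed
  then show ?thesis
    by (metis invertible_det_nz invertible_left_inverse matrix_left_invertible_ker)
qed

text \<open>Testing a combination of the N differentials on the N directions of the q_s alone leads
  to a square matrix.\<close>

lemma differentials_independent_Finv:
  fixes x :: "'n::finite phase"
  assumes "\<And>c. (\<And>s. (\<Sum>k<CARD('n). c k * dFgen \<alpha> x (0, axis s 1) $$ k) = 0)
             \<Longrightarrow> (\<forall>k<CARD('n). c k = 0)"
  shows "differentials_independent_at CARD('n) (Finv \<alpha>) x"
  unfolding differentials_independent_at_def frechet_derivative_Finv
  using assms Finv_has_derivative unfolding differentiable_def by blast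

text \<open>Along \<open>t \<mapsto> (p, t q)\<close> the matrix of the derivatives in the directions of the \<open>q\<^sub>s\<close>
  is affine in \<open>t\<close>, and at \<open>t = 0\<close> it is a Vandermonde matrix up to scaling of rows and columns.\<close>

lemma finite_dependent_on_ray:
  fixes p q :: "real ^ 'n"
  assumes "inj (\<lambda>j. (\<alpha> $ j)\<^sup>2)" and "\<And>s. p $ s \<noteq> 0"
  shows "finite {t. \<not> differentials_independent_at CARD('n) (Finv \<alpha>) (p, t *\<^sub>R q)}"
proof -
  obtain f :: "'n \<Rightarrow> nat" where f: "bij_betw f UNIV {..<CARD('n)}"
    using ex_bij_betw_finite_nat[of "UNIV :: 'n set"] by (auto simp: atLeast0LessThan)
  define a0 where "a0 s k = dFgen \<alpha> (p, 0) (0, axis s 1) $$ k" for s :: 'n and k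
  define a1 where "a1 s k = dFgen \<alpha> (p, q) (0, axis s 1) $$ k - a0 s k" for s :: 'n and k
  define A where "A = (\<chi> s i. a0 s (f i))"
  define B where "B = (\<chi> s i. a1 s (f i))"
  \<comment> \<open>\<open>Mgen\<close> is affine in q, so its value at t interpolates between t = 0
    and t = 1. By \<open>dFgen_q_axis\<close> the derivative in the direction of q_s is then affine
    in t as well.\<close>
  have M: "Mgen \<alpha> (p, t *\<^sub>R q) = (1 - fps_const t) * Mgen \<alpha> (p, 0) + fps_const t * Mgen \<alpha> (p, q)" for t
    by (rule fps_ext) (simp add: Mgen_nth left_diff_distrib field_simps)
  have "dFgen \<alpha> (p, t *\<^sub>R q) (0, axis s 1)
      = (1 - fps_const t) * dFgen \<alpha> (p, 0) (0, axis s 1) + fps_const t * dFgen \<alpha> (p, q) (0, axis s 1)" for s t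
  proof -
    have c: "fps_const (\<alpha> $ s * (t * q $ s)) = fps_const t * fps_const (\<alpha> $ s * q $ s)" by simp
    show ?thesis unfolding dFgen_q_axis fst_conv snd_conv M vector_scaleR_component real_scaleR_def c
      by (simp add: algebra_simps)
  qed
  then have affine: "dFgen \<alpha> (p, t *\<^sub>R q) (0, axis s 1) $$ k = a0 s k + t * a1 s k" for s t k
    by (simp add: a0_def a1_def left_diff_distrib) (simp add: algebra_simps)
  have "det A \<noteq> 0"
  proof (rule det_nonzero_if_kernel_trivial[OF f])
    show "A $ s $ i = a0 s (f i)" for s i by (simp add: A_def)
    fix c :: "nat \<Rightarrow> real"
    assume c: "\<And>s. (\<Sum>k<CARD('n). c k * a0 s k) = 0"
    \<comment> \<open>At q = 0 the column k = 0 has the factor 1/2 where the Vandermonde pattern has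
      1; halving \<open>c 0\<close> absorbs this.\<close>
    define c' where "c' k = (if k = 0 then c k / 2 else c k)" for k
    have M0: "Mgen \<alpha> (p, 0) = fps_const (1 / 2)"
      by (simp add: Mgen_def)
    have a0: "a0 s k = - p $ s * (if k = 0 then 1 / 2 else (\<alpha> $ s) ^ (2 * k))" for s k
      by (simp add: a0_def dFgen_q_axis M0 geom_def fps_numeral_fps_const mult.assoc)
    have "(\<Sum>k<CARD('n). c' k * ((\<alpha> $ s)\<^sup>2) ^ k) = 0" for s
    proof -
      have "c k * a0 s k = - p $ s * (c' k * ((\<alpha> $ s)\<^sup>2) ^ k)" for k
        by (simp add: a0 c'_def power_mult)
      then have "- p $ s * (\<Sum>k<CARD('n). c' k * ((\<alpha> $ s)\<^sup>2) ^ k) = 0"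
        using c[of s] by (simp only: sum_distrib_left)
      then show ?thesis using assms(2)[of s] by simp
    qed
    then have "c' k = 0" if "k < CARD('n)" for k
      using vandermonde_kernel[OF assms(1)] that by blast
    then show "\<forall>k<CARD('n). c k = 0" by (metis c'_def divide_eq_0_iff zero_neq_numeral)
  qed
  then have fin: "finite {t. det (A + t *\<^sub>R B) = 0}" by (rule finite_roots_det_affine)
  have "differentials_independent_at CARD('n) (Finv \<alpha>) (p, t *\<^sub>R q)" if "det (A + t *\<^sub>R B) \<noteq> 0" for t
  proof (rule differentials_independent_Finv)
    fix c :: "nat \<Rightarrow> real"
    assume "\<And>s. (\<Sum>k<CARD('n). c k * dFgen \<alpha> (p, t *\<^sub>R q) (0, axis s 1) $$ k) = 0"
    then show "\<forall>k<CARD('n). c k = 0"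
      using kernel_trivial_if_det[OF that f, of "\<lambda>s k. a0 s k + t * a1 s k" c]
      by (simp add: A_def B_def affine)
  qed
  then show ?thesis by (intro finite_subset[OF _ fin]) blast
qed

lemma frechet_derivative_Finv_0:
  "frechet_derivative (Finv \<alpha> 0) (at x)
     = (\<lambda>v. - (1 + fst x \<bullet> snd x) / 2 * (fst x \<bullet> snd v + fst v \<bullet> snd x))"
  by (simp add: frechet_derivative_Finv dFgen_def dMgen_def Mgen_nth fps_sum_nth geom_def
      fps_numeral_fps_const mult.assoc fun_eq_iff field_simps)

lemma frechet_derivative_Finv_0_nonzero_iff:
  "frechet_derivative (Finv \<alpha> 0) (at x) \<noteq> (\<lambda>v. 0) \<longleftrightarrow> 1 + fst x \<bullet> snd x \<noteq> 0 \<and> x \<noteq> 0"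
proof -
  \<comment> \<open>The test vector (q, p) turns the linear form into |p|^2 + |q|^2.\<close>
  have "fst x \<bullet> snd (snd x, fst x) + fst (snd x, fst x) \<bullet> snd x \<noteq> 0" if "x \<noteq> 0"
    using that by (simp add: prod_eq_iff add_nonneg_eq_0_iff)
  then show ?thesis unfolding frechet_derivative_Finv_0 fun_eq_iff
    by (cases "x = 0") (auto simp: prod_eq_iff)
qed

text \<open>A given point is approached in two small moves: the zero coordinates of p are perturbed,
  then q is rescaled by some t near 1 that avoids the finite set of
  \<open>finite_dependent_on_ray\<close>.\<close>

lemma functionally_independent_Finv:
  fixes \<alpha> :: "real ^ 'n"
  assumes "inj (\<lambda>j. (\<alpha> $ j)\<^sup>2)"
  shows "functionally_independent_on
    {x. frechet_derivative (Finv \<alpha> 0) (at x) \<noteq> (\<lambda>v. 0)} CARD('n) (Finv \<alpha>)"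
  unfolding functionally_independent_on_def
proof
  define W :: "'n phase set" where "W = {x. frechet_derivative (Finv \<alpha> 0) (at x) \<noteq> (\<lambda>v. 0)}"
  define G where "G = {x \<in> W. differentials_independent_at CARD('n) (Finv \<alpha>) x}"
  have "W = {x. 1 + fst x \<bullet> snd x \<noteq> 0} \<inter> - {0}"
    unfolding W_def frechet_derivative_Finv_0_nonzero_iff by auto
  moreover have "open {x :: 'n phase. 1 + fst x \<bullet> snd x \<noteq> 0}"
    by (intro open_Collect_neq continuous_intros)
  ultimately have "open W" by (simp only: open_Int open_Compl closed_singleton)
  fix x assume x: "x \<in> {x. frechet_derivative (Finv \<alpha> 0) (at x) \<noteq> (\<lambda>v. 0)}"
  obtain p q where pq: "x = (p, q)" by (cases x)
  \<comment> \<open>Indicator of the zero coordinates of p: for \<epsilon> \<noteq> 0 no coordinate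
    of p + \<epsilon> e vanishes.\<close>
  define e :: "real ^ 'n" where "e = (\<chi> s. if p $ s = 0 then 1 else 0)"
  have "\<exists>z\<in>G. dist z x < r" if "r > 0" for r
  proof -
    have op: "open (W \<inter> ball x r)" using \<open>open W\<close> by auto
    have xW: "x \<in> W \<inter> ball x r" using x that by (simp add: W_def)
    have "((\<lambda>\<epsilon>. (p + \<epsilon> *\<^sub>R e, q)) \<longlongrightarrow> (p + 0 *\<^sub>R e, q)) (at 0)" by (intro tendsto_intros)
    then have "\<forall>\<^sub>F \<epsilon> in at 0. (p + \<epsilon> *\<^sub>R e, q) \<in> W \<inter> ball x r"
      by (rule topological_tendstoD[OF _ op]) (use xW in \<open>simp add: pq\<close>)
    then have "\<forall>\<^sub>F \<epsilon> in at 0. (p + \<epsilon> *\<^sub>R e, q) \<in> W \<inter> ball x r \<and> \<epsilon> \<noteq> 0"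
      by (intro eventually_conj eventually_neq_at_within)
    then obtain \<epsilon> where \<epsilon>: "(p + \<epsilon> *\<^sub>R e, q) \<in> W \<inter> ball x r" "\<epsilon> \<noteq> 0"
      using eventually_happens' trivial_limit_at by blast
    define p' where "p' = p + \<epsilon> *\<^sub>R e"
    have p': "p' $ s \<noteq> 0" for s using \<epsilon>(2) by (simp add: p'_def e_def)
    have "((\<lambda>t. (p', t *\<^sub>R q)) \<longlongrightarrow> (p', 1 *\<^sub>R q)) (at 1)" by (intro tendsto_intros)
    then have "\<forall>\<^sub>F t in at 1. (p', t *\<^sub>R q) \<in> W \<inter> ball x r"
      by (rule topological_tendstoD[OF _ op]) (use \<epsilon>(1) in \<open>simp add: p'_def\<close>)
    moreover have "\<forall>\<^sub>F t in at 1. differentials_independent_at CARD('n) (Finv \<alpha>) (p', t *\<^sub>R q)"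
    proof -
      have "\<not> 1 islimpt {t. \<not> differentials_independent_at CARD('n) (Finv \<alpha>) (p', t *\<^sub>R q)}"
        by (intro islimpt_finite finite_dependent_on_ray assms p')
      then show ?thesis by (simp add: islimpt_iff_eventually)
    qed
    ultimately have "\<forall>\<^sub>F t in at 1. (p', t *\<^sub>R q) \<in> W \<inter> ball x r \<and>
        differentials_independent_at CARD('n) (Finv \<alpha>) (p', t *\<^sub>R q)"
      by (rule eventually_conj)
    then obtain t where "(p', t *\<^sub>R q) \<in> W \<inter> ball x r"
        "differentials_independent_at CARD('n) (Finv \<alpha>) (p', t *\<^sub>R q)"
      using eventually_happens' trivial_limit_at by blast
    then show ?thesis by (intro bexI[of _ "(p', t *\<^sub>R q)"]) (auto simp: G_def dist_commute)
  qed
  then show "x \<in> closure {x \<in> {x. frechet_derivative (Finv \<alpha> 0) (at x) \<noteq> (\<lambda>v. 0)}.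
      differentials_independent_at CARD('n) (Finv \<alpha>) x}"
    by (simp add: closure_approachable G_def W_def)
qed

section \<open>Invariance\<close>

text \<open>The two square roots of the map merged into one. Since \<open>sqrt\<close> is extended
  as an odd function, it is multiplicative on all reals, so this is the denominator also when
  \<beta>^2 - \<alpha>_j^2 and \<Upsilon> are both negative.\<close>

definition kappa :: "real ^ 'n \<Rightarrow> real \<Rightarrow> ('n phase \<Rightarrow> real) \<Rightarrow> 'n phase \<Rightarrow> 'n \<Rightarrow> real" where
  "kappa \<alpha> \<beta> b x j = sqrt ((\<beta>\<^sup>2 - (\<alpha> $ j)\<^sup>2) * Upsilon \<alpha> \<beta> b x)"

lemma S_map_nth:
  "fst (S_map \<alpha> \<beta> b x) $ j = ((Upsilon \<alpha> \<beta> b x - (\<alpha> $ j)\<^sup>2) * fst x $ j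
      + \<alpha> $ j * a_coeff \<alpha> x * snd x $ j) / kappa \<alpha> \<beta> b x j"
  "snd (S_map \<alpha> \<beta> b x) $ j = (\<alpha> $ j * b x * fst x $ j + \<beta>\<^sup>2 * snd x $ j) / kappa \<alpha> \<beta> b x j"
proof -
  have "Upsilon \<alpha> \<beta> b x - (\<alpha> $ j)\<^sup>2 = - (\<alpha> $ j)\<^sup>2 + \<beta>\<^sup>2 + a_coeff \<alpha> x * b x"
    by (simp add: Upsilon_def)
  then show "fst (S_map \<alpha> \<beta> b x) $ j = ((Upsilon \<alpha> \<beta> b x - (\<alpha> $ j)\<^sup>2) * fst x $ j
      + \<alpha> $ j * a_coeff \<alpha> x * snd x $ j) / kappa \<alpha> \<beta> b x j"
    by (simp add: S_map_def Let_def kappa_def real_sqrt_mult)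
  show "snd (S_map \<alpha> \<beta> b x) $ j = (\<alpha> $ j * b x * fst x $ j + \<beta>\<^sup>2 * snd x $ j) / kappa \<alpha> \<beta> b x j"
    by (simp add: S_map_def Let_def kappa_def real_sqrt_mult)
qed

text \<open>The assumptions are the four entries of L' T = T L for L = ((M, -U), (W, -M)), L'
  likewise, and T = ((A, B), (C, D)); determinants are multiplicative.\<close>

lemma L_conjugation_det:
  fixes M M' :: "'a::comm_ring_1"
  assumes "M' * A - U' * C = A * M + B * W"
    and "M' * B - U' * D = - A * U - B * M"
    and "W' * A - M' * C = C * M + D * W"
    and "W' * B - M' * D = - C * U - D * M"
  shows "(U' * W' - M' * M') * (A * D - B * C) = (U * W - M * M) * (A * D - B * C)"
proof -
  have "(U' * W' - M' * M') * (A * D - B * C)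
      = (M' * A - U' * C) * (W' * B - M' * D) - (M' * B - U' * D) * (W' * A - M' * C)"
    by (simp add: algebra_simps)
  also have "\<dots> = (A * M + B * W) * (- C * U - D * M) - (- A * U - B * M) * (C * M + D * W)"
    by (simp only: assms)
  also have "\<dots> = (U * W - M * M) * (A * D - B * C)"
    by (simp add: algebra_simps)
  finally show ?thesis .
qed

lemma Apow_inner: "Apow \<alpha> k y \<bullet> z = (\<Sum>j\<in>UNIV. (\<alpha> $ j) ^ k * (y $ j * z $ j))"
  by (simp add: Apow_def inner_vec_def mult.assoc)

section \<open>Algebra of the map at a single point\<close>

locale branch_point =
  fixes \<alpha> :: "real ^ 'n" and \<beta> :: real and b :: "'n phase \<Rightarrow> real" and x :: "'n phase"
  assumes beta: "\<beta> \<noteq> 0"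
    and d_nz: "1 + fst x \<bullet> snd x \<noteq> 0"
    and pos: "\<And>j. (\<beta>\<^sup>2 - (\<alpha> $ j)\<^sup>2) * Upsilon \<alpha> \<beta> b x > 0"
    and b_eq: "b x = - (Apow \<alpha> 1 (snd (S_map \<alpha> \<beta> b x)) \<bullet> snd (S_map \<alpha> \<beta> b x)) / (1 + fst x \<bullet> snd x)"
begin

definition "a = a_coeff \<alpha> x"
definition "Y = Upsilon \<alpha> \<beta> b x"
definition "k j = kappa \<alpha> \<beta> b x j"
definition "d = 1 + fst x \<bullet> snd x"
definition "p j = fst x $ j"
definition "q j = snd x $ j"
definition "P j = fst (S_map \<alpha> \<beta> b x) $ j"
definition "Q j = snd (S_map \<alpha> \<beta> b x) $ j"

lemma k_pos: "k j > 0"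
  using pos[of j] by (simp add: k_def kappa_def)

lemma k_square: "k j * k j = (\<beta>\<^sup>2 - (\<alpha> $ j)\<^sup>2) * Y"
  using pos[of j] by (simp add: k_def kappa_def Y_def)

lemma Y_eq: "Y = \<beta>\<^sup>2 + a * b x"
  by (simp add: Y_def a_def Upsilon_def)

lemma Y_nz: "Y \<noteq> 0"
  using pos[of undefined] by (auto simp: Y_def)

lemma kQ: "k j * Q j = \<alpha> $ j * b x * p j + \<beta>\<^sup>2 * q j"
  using k_pos[of j] by (simp add: Q_def S_map_nth k_def p_def q_def)

lemma kP: "k j * P j = (Y - (\<alpha> $ j)\<^sup>2) * p j + \<alpha> $ j * a * q j"
  using k_pos[of j] by (simp add: P_def S_map_nth k_def p_def q_def Y_def a_def)

text \<open>The unnormalised block has determinant (\<beta>^2 - \<alpha>_j^2) Y =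
  \<open>k j * k j\<close>, so the normalised one is inverted by its adjugate. This row recovers p;
  \<open>inverse_q\<close> is the row recovering q.\<close>

lemma beta_P: "\<beta>\<^sup>2 * P j = k j * p j + \<alpha> $ j * a * Q j"
proof -
  have "k j * (\<beta>\<^sup>2 * P j) = \<beta>\<^sup>2 * (k j * P j)" by simp
  also have "\<dots> = (k j * k j) * p j + \<alpha> $ j * a * (k j * Q j)"
    unfolding kP kQ k_square Y_eq by (simp add: algebra_simps power2_eq_square)
  also have "\<dots> = k j * (k j * p j + \<alpha> $ j * a * Q j)" by (simp add: algebra_simps)
  finally show ?thesis using k_pos[of j] by simp
qed

lemma inverse_q: "(Y - (\<alpha> $ j)\<^sup>2) * Q j - \<alpha> $ j * b x * P j = k j * q j"
proof -
  have "k j * ((Y - (\<alpha> $ j)\<^sup>2) * Q j - \<alpha> $ j * b x * P j)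
      = (Y - (\<alpha> $ j)\<^sup>2) * (k j * Q j) - \<alpha> $ j * b x * (k j * P j)"
    by (simp add: algebra_simps)
  also have "\<dots> = (k j * k j) * q j"
    unfolding kP kQ k_square Y_eq by (simp add: algebra_simps power2_eq_square)
  finally show ?thesis using k_pos[of j] by simp
qed

text \<open>The residue matrix is the rank one product of the column (p, q) and the row (q, -p). The
  block T at \<lambda> = \<alpha>_j maps the column to k times its image, and from the right the
  image row to k times the old row. So R' T = T R; this is entry 11, and the next three lemmas are
  the other entries.\<close>

lemma lax11: "(Y - (\<alpha> $ j)\<^sup>2) * (P j * Q j) - \<alpha> $ j * b x * (P j * P j)
    = (Y - (\<alpha> $ j)\<^sup>2) * (p j * q j) + \<alpha> $ j * a * (q j * q j)"
proof -
  have "(Y - (\<alpha> $ j)\<^sup>2) * (P j * Q j) - \<alpha> $ j * b x * (P j * P j)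
    = ((Y - (\<alpha> $ j)\<^sup>2) * Q j - \<alpha> $ j * b x * P j) * P j" by (simp add: algebra_simps)
  also have "\<dots> = (k j * P j) * q j" by (simp add: inverse_q)
  finally show ?thesis unfolding kP by (simp add: algebra_simps)
qed

lemma lax12: "\<alpha> $ j * a * (P j * Q j) - \<beta>\<^sup>2 * (P j * P j)
    = - (Y - (\<alpha> $ j)\<^sup>2) * (p j * p j) - \<alpha> $ j * a * (p j * q j)"
proof -
  have "\<alpha> $ j * a * (P j * Q j) - \<beta>\<^sup>2 * (P j * P j)
    = (\<alpha> $ j * a * Q j - \<beta>\<^sup>2 * P j) * P j" by (simp add: algebra_simps)
  also have "\<dots> = - (k j * P j) * p j" by (simp add: beta_P)
  finally show ?thesis unfolding kP by (simp add: algebra_simps)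
qed

lemma lax21: "(Y - (\<alpha> $ j)\<^sup>2) * (Q j * Q j) - \<alpha> $ j * b x * (P j * Q j)
    = \<alpha> $ j * b x * (p j * q j) + \<beta>\<^sup>2 * (q j * q j)"
proof -
  have "(Y - (\<alpha> $ j)\<^sup>2) * (Q j * Q j) - \<alpha> $ j * b x * (P j * Q j)
    = ((Y - (\<alpha> $ j)\<^sup>2) * Q j - \<alpha> $ j * b x * P j) * Q j" by (simp add: algebra_simps)
  also have "\<dots> = (k j * Q j) * q j" by (simp add: inverse_q)
  finally show ?thesis unfolding kQ by (simp add: algebra_simps)
qed

lemma lax22: "\<alpha> $ j * a * (Q j * Q j) - \<beta>\<^sup>2 * (P j * Q j)
    = - \<alpha> $ j * b x * (p j * p j) - \<beta>\<^sup>2 * (p j * q j)"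
proof -
  have "\<alpha> $ j * a * (Q j * Q j) - \<beta>\<^sup>2 * (P j * Q j)
    = (\<alpha> $ j * a * Q j - \<beta>\<^sup>2 * P j) * Q j" by (simp add: algebra_simps)
  also have "\<dots> = - (k j * Q j) * p j" by (simp add: beta_P)
  finally show ?thesis unfolding kQ by (simp add: algebra_simps)
qed

section \<open>Moments of both points and their intertwining relations\<close>

definition "mu i = Apow \<alpha> i (fst x) \<bullet> snd x"
definition "up i = Apow \<alpha> i (fst x) \<bullet> fst x"
definition "wq i = Apow \<alpha> i (snd x) \<bullet> snd x"
definition "Mu i = Apow \<alpha> i (fst (S_map \<alpha> \<beta> b x)) \<bullet> snd (S_map \<alpha> \<beta> b x)"
definition "Up i = Apow \<alpha> i (fst (S_map \<alpha> \<beta> b x)) \<bullet> fst (S_map \<alpha> \<beta> b x)"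
definition "Wq i = Apow \<alpha> i (snd (S_map \<alpha> \<beta> b x)) \<bullet> snd (S_map \<alpha> \<beta> b x)"

lemmas moments = mu_def up_def wq_def Mu_def Up_def Wq_def Apow_inner
  P_def[symmetric] Q_def[symmetric] p_def[symmetric] q_def[symmetric]

text \<open>A common shape for the next four relations, in which the entries of R' T = T R are
  weighted by \<alpha>_j^i and summed over j.\<close>

lemma moment_combination:
  "y1 * (\<Sum>j\<in>UNIV. \<alpha> $ j ^ i * f1 j) + y2 * (\<Sum>j\<in>UNIV. \<alpha> $ j ^ (i + 2) * f1 j)
   + y3 * (\<Sum>j\<in>UNIV. \<alpha> $ j ^ (i + 1) * f2 j)
   = (\<Sum>j\<in>UNIV. \<alpha> $ j ^ i * (y1 * f1 j + y2 * (\<alpha> $ j)\<^sup>2 * f1 j + y3 * \<alpha> $ j * f2 j))"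
  by (simp add: sum_distrib_left sum.distrib[symmetric] algebra_simps power2_eq_square)

lemma moments11: "Y * Mu i - Mu (i + 2) - b x * Up (i + 1) = Y * mu i - mu (i + 2) + a * wq (i + 1)"
proof -
  have "Y * Mu i + (-1) * Mu (i + 2) + (- b x) * Up (i + 1) = Y * mu i + (-1) * mu (i + 2) + a * wq (i + 1)"
    unfolding moments moment_combination
    by (intro sum.cong refl arg_cong2[where f = "(*)"]) (use lax11 in \<open>simp add: algebra_simps\<close>)
  then show ?thesis by simp
qed

lemma moments21: "Y * Wq i - Wq (i + 2) - b x * Mu (i + 1) = b x * mu (i + 1) + \<beta>\<^sup>2 * wq i"
proof -
  \<comment> \<open>The term with coefficient 0 is padding that makes both sides instances of
    \<open>moment_combination\<close>.\<close>
  have "Y * Wq i + (-1) * Wq (i + 2) + (- b x) * Mu (i + 1) = \<beta>\<^sup>2 * wq i + 0 * wq (i + 2) + b x * mu (i + 1)"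
    unfolding moments moment_combination
    by (intro sum.cong refl arg_cong2[where f = "(*)"]) (use lax21 in \<open>simp add: algebra_simps\<close>)
  then show ?thesis by simp
qed

lemma moments12: "a * Mu (i + 1) - \<beta>\<^sup>2 * Up i = - Y * up i + up (i + 2) - a * mu (i + 1)"
proof -
  have "- \<beta>\<^sup>2 * Up i + 0 * Up (i + 2) + a * Mu (i + 1) = - Y * up i + 1 * up (i + 2) + (- a) * mu (i + 1)"
    unfolding moments moment_combination
    by (intro sum.cong refl arg_cong2[where f = "(*)"]) (use lax12 in \<open>simp add: algebra_simps\<close>)
  then show ?thesis by simp
qed

lemma moments22: "a * Wq (i + 1) - \<beta>\<^sup>2 * Mu i = - b x * up (i + 1) - \<beta>\<^sup>2 * mu i"
proof -
  have "- \<beta>\<^sup>2 * Mu i + 0 * Mu (i + 2) + a * Wq (i + 1) = - \<beta>\<^sup>2 * mu i + 0 * mu (i + 2) + (- b x) * up (i + 1)"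
    unfolding moments moment_combination
    by (intro sum.cong refl arg_cong2[where f = "(*)"]) (use lax22 in \<open>simp add: algebra_simps\<close>)
  then show ?thesis by simp
qed

lemma constraint_a: "up (Suc 0) = a * d"
  using d_nz by (simp add: up_def a_def d_def a_coeff_def Let_def)

lemma constraint_b: "Wq (Suc 0) = - b x * d"
  using d_nz by (subst b_eq) (simp add: Wq_def d_def)

text \<open>In \<open>moments22\<close> at i = 0 the two constraints turn both a * Wq 1 and -b * up
  1 into -a b d, which leaves \<beta>^2 times the two inner products.\<close>

lemma inner_invariant: "fst (S_map \<alpha> \<beta> b x) \<bullet> snd (S_map \<alpha> \<beta> b x) = fst x \<bullet> snd x"
proof -
  have "Mu 0 = mu 0" using moments22[of 0] beta by (simp add: constraint_a constraint_b)
  then show ?thesis by (simp add: Mu_def mu_def Apow_def)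
qed

text \<open>The moment relations give L' T = T L for the full series, and det T is a nonzero series
  in an integral domain, so it cancels.\<close>

lemma Fgen_invariant: "Fgen \<alpha> (S_map \<alpha> \<beta> b x) = Fgen \<alpha> x"
proof -
  let ?x = "S_map \<alpha> \<beta> b x"
  \<comment> \<open>The intertwining matrix times X = \<lambda>^-2, conjugated by diag(\<lambda>, 1)
    to remove the odd powers of \<lambda>.\<close>
  let ?A = "fps_const Y * fps_X - 1" and ?B = "fps_const a" and ?C = "fps_const (b x) * fps_X"
    and ?D = "fps_const (\<beta>\<^sup>2) * fps_X"
  have M: "Mgen \<alpha> x $$ i = (if i = 0 then d / 2 else mu (2 * i))"
    and M': "Mgen \<alpha> ?x $$ i = (if i = 0 then d / 2 else Mu (2 * i))" for i
    by (simp_all add: Mgen_nth d_def mu_def Mu_def inner_invariant)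
  \<comment> \<open>The constant term of \<open>Mgen\<close> is d / 2, while the moment of order 0
    is d - 1. As d is the same at both points, the relations of lowest order survive this
    discrepancy.\<close>
  have mu0: "mu 0 = d - 1" "Mu 0 = d - 1"
    using inner_invariant by (simp_all add: d_def mu_def Mu_def Apow_def)
  have U: "Qgen \<alpha> (fst x) $$ i = up (2 * i + 1)" "Qgen \<alpha> (fst ?x) $$ i = Up (2 * i + 1)"
    "Qgen \<alpha> (snd x) $$ i = wq (2 * i + 1)" "Qgen \<alpha> (snd ?x) $$ i = Wq (2 * i + 1)" for i
    by (simp_all add: Qgen_nth up_def Up_def wq_def Wq_def)
  note coeffs = M M' U mu0 constraint_a constraint_b
  have e11: "Mgen \<alpha> ?x * ?A - Qgen \<alpha> (fst ?x) * ?C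
      = ?A * Mgen \<alpha> x + ?B * (fps_X * Qgen \<alpha> (snd x))"
  proof (rule fps_ext)
    fix i show "(Mgen \<alpha> ?x * ?A - Qgen \<alpha> (fst ?x) * ?C) $$ i
        = (?A * Mgen \<alpha> x + ?B * (fps_X * Qgen \<alpha> (snd x))) $$ i"
    proof (cases i)
      case (Suc m)
      then show ?thesis using moments11[of "2 * m"] coeffs
        by (cases m) (simp_all add: algebra_simps)
    qed (simp add: coeffs algebra_simps)
  qed
  \<comment> \<open>The coefficient at X^0 here is the constraint on a, and the one in
    \<open>e21\<close> the constraint on b; the higher coefficients are moment relations.\<close>
  have e12: "Mgen \<alpha> ?x * ?B - Qgen \<alpha> (fst ?x) * ?D
      = - ?A * Qgen \<alpha> (fst x) - ?B * Mgen \<alpha> x"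
  proof (rule fps_ext)
    fix i show "(Mgen \<alpha> ?x * ?B - Qgen \<alpha> (fst ?x) * ?D) $$ i
        = (- ?A * Qgen \<alpha> (fst x) - ?B * Mgen \<alpha> x) $$ i"
    proof (cases i)
      case (Suc m)
      then show ?thesis using moments12[of "2 * m + 1"] coeffs
        by (cases m) (simp_all add: algebra_simps)
    qed (simp add: coeffs algebra_simps)
  qed
  have e21: "Qgen \<alpha> (snd ?x) * ?A - Mgen \<alpha> ?x * fps_const (b x)
      = fps_const (b x) * Mgen \<alpha> x + fps_const (\<beta>\<^sup>2) * (fps_X * Qgen \<alpha> (snd x))"
  proof (rule fps_ext)
    fix i show "(Qgen \<alpha> (snd ?x) * ?A - Mgen \<alpha> ?x * fps_const (b x)) $$ i
        = (fps_const (b x) * Mgen \<alpha> x + fps_const (\<beta>\<^sup>2) * (fps_X * Qgen \<alpha> (snd x))) $$ i"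
    proof (cases i)
      case (Suc m)
      then show ?thesis using moments21[of "2 * m + 1"] coeffs
        by (cases m) (simp_all add: algebra_simps)
    qed (simp add: coeffs algebra_simps)
  qed
  have e22: "Qgen \<alpha> (snd ?x) * ?B - Mgen \<alpha> ?x * fps_const (\<beta>\<^sup>2)
      = - fps_const (b x) * Qgen \<alpha> (fst x) - fps_const (\<beta>\<^sup>2) * Mgen \<alpha> x"
  proof (rule fps_ext)
    fix i show "(Qgen \<alpha> (snd ?x) * ?B - Mgen \<alpha> ?x * fps_const (\<beta>\<^sup>2)) $$ i
        = (- fps_const (b x) * Qgen \<alpha> (fst x) - fps_const (\<beta>\<^sup>2) * Mgen \<alpha> x) $$ i"
      using moments22[of "2 * i"] coeffs
      by (cases "i = 0") (simp_all add: algebra_simps)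
  qed
  have e21': "fps_X * Qgen \<alpha> (snd ?x) * ?A - Mgen \<alpha> ?x * ?C = ?C * Mgen \<alpha> x + ?D * (fps_X * Qgen \<alpha> (snd x))"
  proof -
    have "fps_X * Qgen \<alpha> (snd ?x) * ?A - Mgen \<alpha> ?x * ?C
        = fps_X * (Qgen \<alpha> (snd ?x) * ?A - Mgen \<alpha> ?x * fps_const (b x))" by (simp only: algebra_simps)
    then show ?thesis unfolding e21 by (simp only: algebra_simps)
  qed
  have e22': "fps_X * Qgen \<alpha> (snd ?x) * ?B - Mgen \<alpha> ?x * ?D = - ?C * Qgen \<alpha> (fst x) - ?D * Mgen \<alpha> x"
  proof -
    have "fps_X * Qgen \<alpha> (snd ?x) * ?B - Mgen \<alpha> ?x * ?D
        = fps_X * (Qgen \<alpha> (snd ?x) * ?B - Mgen \<alpha> ?x * fps_const (\<beta>\<^sup>2))" by (simp only: algebra_simps)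
    also have "\<dots> = fps_X * (- fps_const (b x) * Qgen \<alpha> (fst x) - fps_const (\<beta>\<^sup>2) * Mgen \<alpha> x)"
      by (simp only: e22)
    finally show ?thesis by (simp only: algebra_simps mult_minus_left mult_minus_right)
  qed
  have "Fgen \<alpha> ?x * (?A * ?D - ?B * ?C) = Fgen \<alpha> x * (?A * ?D - ?B * ?C)"
    unfolding Fgen_def using L_conjugation_det[OF e11 e12 e21' e22'] by (simp only: mult_ac)
  \<comment> \<open>The coefficient of X in the determinant is -(\<beta>^2 + a b) = -Y.\<close>
  moreover have "(?A * ?D - ?B * ?C) $$ 1 \<noteq> 0" using Y_nz by (simp add: Y_eq mult.assoc)
  then have "?A * ?D - ?B * ?C \<noteq> 0" by (metis fps_zero_nth)
  ultimately show ?thesis by (simp only: mult_cancel_right simp_thms)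
qed

end

section \<open>Symplecticity\<close>

lemma differentiable_transform_eventually:
  assumes "f differentiable (at x)" and "\<forall>\<^sub>F y in nhds x. f y = g y"
  shows "g differentiable (at x)"
proof -
  from assms(1) obtain f' where "(f has_derivative f') (at x)" unfolding differentiable_def by blast
  moreover have "\<forall>\<^sub>F y in at x. f y = g y"
    using assms(2) by (auto simp: eventually_at_filter elim: eventually_mono)
  moreover have "f x = g x" by (rule eventually_nhds_x_imp_x[OF assms(2)])
  ultimately show ?thesis
    using has_derivative_transform_eventually[of f f' x UNIV g] unfolding differentiable_def by blast
qed

text \<open>By continuity s keeps its sign near x, so there s = sgn (s x) * sqrt D, with D x >
  0.\<close>

lemma differentiable_square_root:
  fixes s D :: "'a::real_normed_vector \<Rightarrow> real"
  assumes "\<forall>\<^sub>F y in nhds x. (s y)\<^sup>2 = D y" and "isCont s x"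
    and "D differentiable (at x)" and "s x \<noteq> 0"
  shows "s differentiable (at x)"
proof -
  have Dx: "D x = (s x)\<^sup>2" using eventually_nhds_x_imp_x[OF assms(1)] by simp
  obtain D' where D': "(D has_derivative D') (at x)" using assms(3) unfolding differentiable_def by blast
  have "D x > 0" using assms(4) by (simp add: Dx)
  then have "((\<lambda>y. sgn (s x) * sqrt (D y)) has_derivative
      (\<lambda>v. sgn (s x) * (inverse (sqrt (D x)) / 2 * D' v))) (at x)"
    by (auto intro!: derivative_eq_intros D' simp: field_simps)
  then have "(\<lambda>y. sgn (s x) * sqrt (D y)) differentiable (at x)"
    unfolding differentiable_def by blast
  moreover have "\<forall>\<^sub>F y in nhds x. sgn (s x) * sqrt (D y) = s y"
  proof -
    have "((\<lambda>y. s y * sgn (s x)) \<longlongrightarrow> s x * sgn (s x)) (nhds x)"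
      using assms(2) by (intro tendsto_intros) (simp add: continuous_within tendsto_nhds_iff)
    moreover have "s x * sgn (s x) > 0" using assms(4) by (simp add: sgn_if)
    ultimately have "\<forall>\<^sub>F y in nhds x. 0 < s y * sgn (s x)" by (rule order_tendstoD(1))
    with assms(1) show ?thesis
    proof eventually_elim
      case (elim y)
      have "sqrt (D y) = \<bar>s y\<bar>" by (simp flip: elim(1))
      then show ?case using elim(2) by (auto simp: sgn_if abs_if zero_less_mult_iff split: if_splits)
    qed
  qed
  ultimately show ?thesis by (rule differentiable_transform_eventually)
qed

text \<open>With \<open>s = B + A b\<close> one has \<open>s\<^sup>2 = B\<^sup>2 - A C \<noteq> 0\<close>, so that \<open>s\<close> is differentiable, and
  \<open>b\<close> is one of \<open>- C / (B + s)\<close> and \<open>(s - B) / A\<close>, whose denominators do not vanish together.\<close>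

lemma differentiable_quadratic_root:
  fixes A B C b :: "'a::real_normed_vector \<Rightarrow> real"
  assumes quad: "\<forall>\<^sub>F y in nhds x. A y * (b y)\<^sup>2 + 2 * B y * b y + C y = 0"
    and "isCont b x" and [derivative_intros]: "A differentiable (at x)" "B differentiable (at x)" "C differentiable (at x)"
    and disc: "(B x)\<^sup>2 - A x * C x \<noteq> 0"
  shows "b differentiable (at x)"
proof -
  define s where "s y = B y + A y * b y" for y
  have s2: "\<forall>\<^sub>F y in nhds x. (s y)\<^sup>2 = (B y)\<^sup>2 - A y * C y"
    using quad
  proof eventually_elim
    case (elim y)
    have "(s y)\<^sup>2 = (B y)\<^sup>2 - A y * C y + A y * (A y * (b y)\<^sup>2 + 2 * B y * b y + C y)"
      by (simp add: s_def power2_eq_square algebra_simps)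
    then show ?case by (simp add: elim)
  qed
  have sx: "s x \<noteq> 0" using eventually_nhds_x_imp_x[OF s2] disc by auto
  have "isCont s x" unfolding s_def using assms(2-4) differentiable_imp_continuous_within
    by (intro continuous_intros) blast+
  then have s: "s differentiable (at x)"
    by (rule differentiable_square_root[OF s2]) (auto intro!: derivative_intros sx)
  note [derivative_intros] = s
  have ne: "\<forall>\<^sub>F y in nhds x. f y \<noteq> 0" if "f differentiable (at x)" "f x \<noteq> 0" for f :: "'a \<Rightarrow> real"
    using that differentiable_imp_continuous_within[of f x UNIV]
    by (intro tendsto_imp_eventually_ne[of f "f x"]) (auto simp: continuous_within tendsto_nhds_iff)
  show ?thesis
  proof (cases "B x + s x = 0")
    case False
    have d: "(\<lambda>y. B y + s y) differentiable (at x)" by (intro derivative_intros)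
    have "\<forall>\<^sub>F y in nhds x. - C y / (B y + s y) = b y"
      using quad ne[OF d False]
    proof eventually_elim
      case (elim y)
      have "b y * (B y + s y) = - C y" using elim(1) by (simp add: s_def power2_eq_square algebra_simps)
      then show ?case using elim(2) by (simp add: field_simps)
    qed
    then show ?thesis
      by (rule differentiable_transform_eventually[rotated]) (intro derivative_intros False)
  next
    case True
    \<comment> \<open>If A x were 0, then s x = B x, and B x + s x = 0 would force s x = 0.\<close>
    have A: "A x \<noteq> 0" using True sx by (auto simp: s_def)
    have "\<forall>\<^sub>F y in nhds x. (s y - B y) / A y = b y"
      using ne[OF assms(3) A] by eventually_elim (simp add: s_def)
    then show ?thesis
      by (rule differentiable_transform_eventually[rotated]) (intro derivative_intros A)
  qed
qed

text \<open>Here \<open>dp, dq, \<dots>\<close> are the values of the differentials on one tangent vector and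
  \<open>ep, eq, \<dots>\<close> those on another; primed and capital letters belong to the image point. The idea is that
  \<open>\<beta>\<^sup>2 P = k p + \<alpha> a Q\<close> and \<open>k Q = \<alpha> b p + \<beta>\<^sup>2 q\<close> express \<open>P, q\<close> through \<open>p, Q\<close>.\<close>

lemma wedge_identity:
  fixes dp dq dP dQ dk ep eq eP eQ ek p q Q k \<alpha> :: "'n::finite \<Rightarrow> real"
  assumes \<beta>: "\<beta> \<noteq> (0::real)" and Y: "Y = \<beta>\<^sup>2 + a * b" "Y \<noteq> 0"
    and kQ: "\<And>j. k j * Q j = \<alpha> j * b * p j + \<beta>\<^sup>2 * q j"
    and cp: "(\<Sum>j\<in>UNIV. \<alpha> j * (p j * p j)) = a * d"
    and dQ: "\<And>j. dk j * Q j + k j * dQ j = \<alpha> j * db * p j + \<alpha> j * b * dp j + \<beta>\<^sup>2 * dq j"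
    and eQ: "\<And>j. ek j * Q j + k j * eQ j = \<alpha> j * eb * p j + \<alpha> j * b * ep j + \<beta>\<^sup>2 * eq j"
    and dP: "\<And>j. \<beta>\<^sup>2 * dP j = dk j * p j + k j * dp j + \<alpha> j * da * Q j + \<alpha> j * a * dQ j"
    and eP: "\<And>j. \<beta>\<^sup>2 * eP j = ek j * p j + k j * ep j + \<alpha> j * ea * Q j + \<alpha> j * a * eQ j"
    and dk: "\<And>j. dk j = k j * dY / (2 * Y)" and ek: "\<And>j. ek j = k j * eY / (2 * Y)"
    and dY: "dY = da * b + a * db" and eY: "eY = ea * b + a * eb"
    and dd: "dd = (\<Sum>j\<in>UNIV. p j * dq j + q j * dp j)" and ed: "ed = (\<Sum>j\<in>UNIV. p j * eq j + q j * ep j)"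
    and dcp: "2 * (\<Sum>j\<in>UNIV. \<alpha> j * (p j * dp j)) = da * d + a * dd"
    and ecp: "2 * (\<Sum>j\<in>UNIV. \<alpha> j * (p j * ep j)) = ea * d + a * ed"
    and dcQ: "2 * (\<Sum>j\<in>UNIV. \<alpha> j * (Q j * dQ j)) = - (db * d + b * dd)"
    and ecQ: "2 * (\<Sum>j\<in>UNIV. \<alpha> j * (Q j * eQ j)) = - (eb * d + b * ed)"
  shows "(\<Sum>j\<in>UNIV. dP j * eQ j - eP j * dQ j) = (\<Sum>j\<in>UNIV. dp j * eq j - ep j * dq j)"
proof -
  \<comment> \<open>The factor of the logarithmic derivative: dk = t k dY, the same for all
    j.\<close>
  define t where "t = 1 / (2 * Y)"
  \<comment> \<open>Expresses k d(p Q) through the differentiated relation for k Q, at the price of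
    a term in k p Q.\<close>
  have kpart: "k j * (p j * eQ j + Q j * ep j)
      = eb * (\<alpha> j * (p j * p j)) + 2 * b * (\<alpha> j * (p j * ep j)) + \<beta>\<^sup>2 * (p j * eq j + q j * ep j) - t * eY * (k j * p j * Q j)" (is ?th1)
   and kpart': "k j * (p j * dQ j + Q j * dp j)
      = db * (\<alpha> j * (p j * p j)) + 2 * b * (\<alpha> j * (p j * dp j)) + \<beta>\<^sup>2 * (p j * dq j + q j * dp j) - t * dY * (k j * p j * Q j)" (is ?th2) for j
  proof -
    have "k j * (p j * eQ j + Q j * ep j) = p j * (ek j * Q j + k j * eQ j) - p j * ek j * Q j + (k j * Q j) * ep j"
      by (simp add: algebra_simps)
    then show ?th1 unfolding eQ kQ unfolding ek by (simp add: t_def algebra_simps)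
    have "k j * (p j * dQ j + Q j * dp j) = p j * (dk j * Q j + k j * dQ j) - p j * dk j * Q j + (k j * Q j) * dp j"
      by (simp add: algebra_simps)
    then show ?th2 unfolding dQ kQ unfolding dk by (simp add: t_def algebra_simps)
  qed
  \<comment> \<open>The terms in k p Q from \<open>kpart\<close> and \<open>kpart'\<close> have the
    factors t dY t eY with opposite signs and cancel; the sums that remain are those governed by the
    constraints.\<close>
  have term_eq: "\<beta>\<^sup>2 * ((dP j * eQ j - eP j * dQ j) - (dp j * eq j - ep j * dq j))
    = t * dY * (eb * (\<alpha> j * (p j * p j)) + 2 * b * (\<alpha> j * (p j * ep j)) + \<beta>\<^sup>2 * (p j * eq j + q j * ep j))
    - t * eY * (db * (\<alpha> j * (p j * p j)) + 2 * b * (\<alpha> j * (p j * dp j)) + \<beta>\<^sup>2 * (p j * dq j + q j * dp j))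
    + da * (\<alpha> j * (Q j * eQ j)) - ea * (\<alpha> j * (Q j * dQ j))
    - db * (\<alpha> j * (p j * ep j)) + eb * (\<alpha> j * (p j * dp j))" for j
  proof -
    have "\<beta>\<^sup>2 * ((dP j * eQ j - eP j * dQ j) - (dp j * eq j - ep j * dq j))
      = (\<beta>\<^sup>2 * dP j) * eQ j - (\<beta>\<^sup>2 * eP j) * dQ j - (dp j * (\<beta>\<^sup>2 * eq j) - ep j * (\<beta>\<^sup>2 * dq j))"
      by (simp add: algebra_simps)
    also have "\<dots> = dk j * (p j * eQ j + Q j * ep j) - ek j * (p j * dQ j + Q j * dp j)
       - dp j * (ek j * Q j + k j * eQ j + \<beta>\<^sup>2 * eq j) + dp j * (k j * eQ j + ek j * Q j)
       + ep j * (dk j * Q j + k j * dQ j + \<beta>\<^sup>2 * dq j) - ep j * (k j * dQ j + dk j * Q j)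
       + dp j * (k j * eQ j + ek j * Q j) - ep j * (k j * dQ j + dk j * Q j)
       + da * (\<alpha> j * (Q j * eQ j)) - ea * (\<alpha> j * (Q j * dQ j))"
      unfolding dP eP by (simp add: algebra_simps)
    also have "\<dots> = dk j * (p j * eQ j + Q j * ep j) - ek j * (p j * dQ j + Q j * dp j)
       + dp j * (ek j * Q j + k j * eQ j - \<beta>\<^sup>2 * eq j) - ep j * (dk j * Q j + k j * dQ j - \<beta>\<^sup>2 * dq j)
       + da * (\<alpha> j * (Q j * eQ j)) - ea * (\<alpha> j * (Q j * dQ j))"
      by (simp add: algebra_simps)
    also have "\<dots> = t * dY * (k j * (p j * eQ j + Q j * ep j)) - t * eY * (k j * (p j * dQ j + Q j * dp j))
       + dp j * (\<alpha> j * eb * p j + \<alpha> j * b * ep j) - ep j * (\<alpha> j * db * p j + \<alpha> j * b * dp j)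
       + da * (\<alpha> j * (Q j * eQ j)) - ea * (\<alpha> j * (Q j * dQ j))"
      unfolding dQ eQ by (simp add: dk ek t_def mult_ac)
    finally show ?thesis unfolding kpart kpart' by (simp add: algebra_simps)
  qed
  have "\<beta>\<^sup>2 * ((\<Sum>j\<in>UNIV. dP j * eQ j - eP j * dQ j) - (\<Sum>j\<in>UNIV. dp j * eq j - ep j * dq j))
    = t * dY * (eb * (a * d) + b * (ea * d + a * ed) + \<beta>\<^sup>2 * ed)
    - t * eY * (db * (a * d) + b * (da * d + a * dd) + \<beta>\<^sup>2 * dd)
    + (da * - (eb * d + b * ed) + ea * (db * d + b * dd) - db * (ea * d + a * ed) + eb * (da * d + a * dd)) / 2"
  proof -
    have h: "(\<Sum>j\<in>UNIV. \<alpha> j * (p j * dp j)) = (da * d + a * dd) / 2"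
      "(\<Sum>j\<in>UNIV. \<alpha> j * (p j * ep j)) = (ea * d + a * ed) / 2"
      "(\<Sum>j\<in>UNIV. \<alpha> j * (Q j * dQ j)) = - (db * d + b * dd) / 2"
      "(\<Sum>j\<in>UNIV. \<alpha> j * (Q j * eQ j)) = - (eb * d + b * ed) / 2"
      using dcp ecp dcQ ecQ by simp_all
    show ?thesis
      unfolding sum_subtractf[symmetric] sum_distrib_left term_eq
      unfolding sum.distrib sum_subtractf sum_distrib_left[symmetric] h cp
      by (simp add: dd ed sum.distrib field_simps)
  qed
  \<comment> \<open>The coefficients combine through Y = \<beta>^2 + a b and its differential; since
    t Y = 1/2, the remaining wedge of dY and dd cancels.\<close>
  also have "\<dots> = t * dY * (eY * d + Y * ed) - t * eY * (dY * d + Y * dd) - (dY * ed - eY * dd) / 2"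
    unfolding dY eY Y(1) by (simp add: field_simps)
  also have "\<dots> = 0" using Y(2) by (simp add: t_def field_simps)
  finally show ?thesis using \<beta> by simp
qed

section \<open>Differentiability rules for functions on phase space\<close>

lemma differentiable_vec_nth [derivative_intros]:
  "f differentiable F \<Longrightarrow> (\<lambda>x. f x $ i) differentiable F"
  unfolding differentiable_def
  by (blast intro: bounded_linear.has_derivative[OF bounded_linear_vec_nth])

lemma differentiable_vec_lambda:
  fixes f :: "'a::real_normed_vector \<Rightarrow> 'n::finite \<Rightarrow> real"
  assumes "\<And>j. (\<lambda>x. f x j) differentiable (at x)"
  shows "(\<lambda>x. \<chi> j. f x j) differentiable (at x)"
proof -
  from assms obtain f' where f': "\<And>j. ((\<lambda>x. f x j) has_derivative f' j) (at x)"
    unfolding differentiable_def by metis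
  have "((\<lambda>x. \<chi> j. f x j) has_derivative (\<lambda>v. \<chi> j. f' j v)) (at x)"
    unfolding has_derivative_componentwise_within[of "\<lambda>x. \<chi> j. f x j"]
    using f' by (auto simp: Basis_vec_def inner_axis)
  then show ?thesis unfolding differentiable_def by blast
qed

lemma differentiable_fst_snd [derivative_intros]:
  "fst differentiable (at x)" "snd differentiable (at x)"
  using bounded_linear_fst bounded_linear_snd bounded_linear_imp_differentiable by blast+

lemma differentiable_inner [derivative_intros]:
  fixes f g :: "'a::real_normed_vector \<Rightarrow> 'b::real_inner"
  assumes "f differentiable (at x)" "g differentiable (at x)"
  shows "(\<lambda>x. f x \<bullet> g x) differentiable (at x)"
  using assms unfolding differentiable_def by (blast intro: has_derivative_inner)

lemma differentiable_Apow_inner [derivative_intros]: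
  assumes "f differentiable (at x)" "g differentiable (at x)"
  shows "(\<lambda>x. Apow \<alpha> k (f x) \<bullet> g x) differentiable (at x)"
  unfolding Apow_inner by (intro ballI derivative_intros assms) auto

lemma differentiable_Qform [derivative_intros]:
  assumes "f differentiable (at x)" "g differentiable (at x)"
  shows "(\<lambda>x. Qform \<alpha> l (Apow \<alpha> k (f x)) (g x)) differentiable (at x)"
  unfolding Qform_def Apow_def inner_vec_def inner_real_def vec_lambda_beta divide_inverse
  by (intro ballI derivative_intros assms) auto

context branch_point begin

text \<open>The second constraint with Q eliminated by \<open>kQ\<close>. It is the quadratic
  equation for b in terms of the Lax entries, multiplied by \<beta>.\<close>

lemma quadratic: "Qform \<alpha> \<beta> (Apow \<alpha> 1 (fst x)) (fst x) * (b x)\<^sup>2 + 2 * L11 \<alpha> \<beta> x * b x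
   + \<beta>\<^sup>2 * Qform \<alpha> \<beta> (Apow \<alpha> 1 (snd x)) (snd x) = 0"
proof -
  define r where "r j = \<alpha> $ j / (\<beta>\<^sup>2 - (\<alpha> $ j)\<^sup>2)" for j
  have nz: "\<beta>\<^sup>2 - (\<alpha> $ j)\<^sup>2 \<noteq> 0" for j using pos[of j] by auto
  have Qj: "Y * (\<alpha> $ j * (Q j * Q j)) = r j * (\<alpha> $ j * b x * p j + \<beta>\<^sup>2 * q j)\<^sup>2" for j
  proof -
    have "(k j * k j) * (Q j * Q j) = (\<alpha> $ j * b x * p j + \<beta>\<^sup>2 * q j)\<^sup>2"
      unfolding kQ[symmetric] by (simp add: power2_eq_square mult_ac)
    then show ?thesis unfolding k_square using nz[of j] by (simp add: r_def field_simps)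
  qed
  have up1: "(\<Sum>j\<in>UNIV. \<alpha> $ j * (p j * p j)) = a * d"
    using constraint_a by (simp add: up_def Apow_inner p_def)
  have Wq1: "(\<Sum>j\<in>UNIV. \<alpha> $ j * (Q j * Q j)) = - b x * d"
    using constraint_b by (simp add: Wq_def Apow_inner Q_def)
  \<comment> \<open>From (\<beta>^2 - \<alpha>^2) r = \<alpha>; the -\<alpha> contributes -b^2 a d,
    which cancels the a b part of Y on the left-hand side below.\<close>
  have r: "(\<alpha> $ j)\<^sup>2 * r j = \<beta>\<^sup>2 * r j - \<alpha> $ j" for j
    using nz[of j] by (simp add: r_def field_simps power2_eq_square)
  have "- b x * d * Y = (\<Sum>j\<in>UNIV. r j * (\<alpha> $ j * b x * p j + \<beta>\<^sup>2 * q j)\<^sup>2)"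
    unfolding Wq1[symmetric] Qj[symmetric] sum_distrib_left[symmetric] by (rule mult.commute)
  also have "\<dots> = (\<Sum>j\<in>UNIV. (b x)\<^sup>2 * (\<beta>\<^sup>2 * (r j * (p j * p j)) - \<alpha> $ j * (p j * p j))
      + 2 * b x * \<beta>\<^sup>2 * (\<alpha> $ j * r j * (p j * q j)) + \<beta>\<^sup>2 * \<beta>\<^sup>2 * (r j * (q j * q j)))"
  proof (rule sum.cong[OF refl])
    fix j
    have "r j * (\<alpha> $ j * b x * p j + \<beta>\<^sup>2 * q j)\<^sup>2 = (b x)\<^sup>2 * (((\<alpha> $ j)\<^sup>2 * r j) * (p j * p j))
      + 2 * b x * \<beta>\<^sup>2 * (\<alpha> $ j * r j * (p j * q j)) + \<beta>\<^sup>2 * \<beta>\<^sup>2 * (r j * (q j * q j))"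
      by (simp add: power2_eq_square algebra_simps)
    then show "r j * (\<alpha> $ j * b x * p j + \<beta>\<^sup>2 * q j)\<^sup>2
      = (b x)\<^sup>2 * (\<beta>\<^sup>2 * (r j * (p j * p j)) - \<alpha> $ j * (p j * p j))
      + 2 * b x * \<beta>\<^sup>2 * (\<alpha> $ j * r j * (p j * q j)) + \<beta>\<^sup>2 * \<beta>\<^sup>2 * (r j * (q j * q j))"
      unfolding r by (simp add: algebra_simps)
  qed
  also have "\<dots> = (b x)\<^sup>2 * (\<beta>\<^sup>2 * (\<Sum>j\<in>UNIV. r j * (p j * p j)) - a * d)
      + 2 * b x * \<beta>\<^sup>2 * (\<Sum>j\<in>UNIV. \<alpha> $ j * r j * (p j * q j)) + \<beta>\<^sup>2 * \<beta>\<^sup>2 * (\<Sum>j\<in>UNIV. r j * (q j * q j))"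
    unfolding up1[symmetric]
    by (simp only: sum.distrib sum_subtractf sum_distrib_left[symmetric])
  finally have "\<beta>\<^sup>2 * ((\<Sum>j\<in>UNIV. r j * (p j * p j)) * (b x)\<^sup>2
      + 2 * (d / 2 + (\<Sum>j\<in>UNIV. \<alpha> $ j * r j * (p j * q j))) * b x + \<beta>\<^sup>2 * (\<Sum>j\<in>UNIV. r j * (q j * q j))) = 0"
    unfolding Y_eq by (simp add: algebra_simps power2_eq_square)
  moreover have "Qform \<alpha> \<beta> (Apow \<alpha> 1 (fst x)) (fst x) = (\<Sum>j\<in>UNIV. r j * (p j * p j))"
    "Qform \<alpha> \<beta> (Apow \<alpha> 1 (snd x)) (snd x) = (\<Sum>j\<in>UNIV. r j * (q j * q j))"
    "L11 \<alpha> \<beta> x = d / 2 + (\<Sum>j\<in>UNIV. \<alpha> $ j * r j * (p j * q j))"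
    by (simp_all add: Qform_def L11_def Apow_def inner_vec_def r_def p_def q_def d_def Let_def
        power2_eq_square mult.assoc)
  ultimately show ?thesis using beta by simp
qed

end

section \<open>Differentiability on the open set of a branch, and the symplectic form\<close>

locale branch =
  fixes \<alpha> :: "real ^ 'n" and \<beta> :: real and U :: "'n phase set" and b :: "'n phase \<Rightarrow> real"
  assumes beta: "\<beta> \<noteq> 0" and branch: "breve_b_branch \<alpha> \<beta> U b"
begin

lemma open_U: "open U"
  using branch by (simp add: breve_b_branch_def)

lemma branch_point: "x \<in> U \<Longrightarrow> branch_point \<alpha> \<beta> b x"
  using beta branch by unfold_locales (auto simp: breve_b_branch_def)

text \<open>A branch is only assumed continuous; the quadratic equation with nonvanishing
  discriminant upgrades this to differentiability.\<close>

lemma b_differentiable: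
  assumes "x \<in> U"
  shows "b differentiable (at x)"
proof (rule differentiable_quadratic_root)
  show "\<forall>\<^sub>F y in nhds x. Qform \<alpha> \<beta> (Apow \<alpha> 1 (fst y)) (fst y) * (b y)\<^sup>2 + 2 * L11 \<alpha> \<beta> y * b y
     + \<beta>\<^sup>2 * Qform \<alpha> \<beta> (Apow \<alpha> 1 (snd y)) (snd y) = 0"
    using open_U assms by (rule eventually_nhds_in_open[THEN eventually_mono])
      (rule branch_point.quadratic[OF branch_point])
  show "isCont b x"
    using branch assms open_U by (auto simp: breve_b_branch_def continuous_on_eq_continuous_at)
  \<comment> \<open>A quarter of the discriminant of the quadratic equation is
    -\<open>detL \<alpha> \<beta> x\<close>.\<close>
  have "detL \<alpha> \<beta> x \<noteq> 0" using branch assms by (simp add: breve_b_branch_def)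
  then show "(L11 \<alpha> \<beta> x)\<^sup>2 - Qform \<alpha> \<beta> (Apow \<alpha> 1 (fst x)) (fst x) *
      (\<beta>\<^sup>2 * Qform \<alpha> \<beta> (Apow \<alpha> 1 (snd x)) (snd x)) \<noteq> 0"
    by (simp add: detL_def L12_def L21_def Let_def power2_eq_square mult_ac)
  show "L11 \<alpha> \<beta> differentiable (at x)"
    unfolding L11_def[abs_def] Let_def by (intro derivative_intros) auto
qed (intro derivative_intros)+

lemma a_coeff_differentiable:
  assumes "1 + fst x \<bullet> snd x \<noteq> 0"
  shows "a_coeff \<alpha> differentiable (at x)"
  unfolding a_coeff_def[abs_def] Let_def by (intro derivative_intros assms)

lemma Upsilon_differentiable:
  assumes "x \<in> U"
  shows "Upsilon \<alpha> \<beta> b differentiable (at x)"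
  unfolding Upsilon_def[abs_def]
  by (intro derivative_intros b_differentiable a_coeff_differentiable assms
      branch_point.d_nz[OF branch_point])

text \<open>The square of \<open>kappa\<close> is a constant multiple of \<Upsilon>, so its
  logarithmic derivative is half that of \<Upsilon>.\<close>

lemma kappa_has_derivative:
  assumes "x \<in> U" and "(Upsilon \<alpha> \<beta> b has_derivative Y') (at x)"
  shows "((\<lambda>y. kappa \<alpha> \<beta> b y j) has_derivative
    (\<lambda>v. kappa \<alpha> \<beta> b x j * Y' v / (2 * Upsilon \<alpha> \<beta> b x))) (at x)"
proof -
  interpret branch_point \<alpha> \<beta> b x using branch_point[OF assms(1)] .
  have eq: "(\<beta>\<^sup>2 - (\<alpha> $ j)\<^sup>2) * c * (inverse (sqrt ((\<beta>\<^sup>2 - (\<alpha> $ j)\<^sup>2) * Y)) / 2) = k j * c / (2 * Y)" for c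
  proof -
    have "(\<beta>\<^sup>2 - (\<alpha> $ j)\<^sup>2) = k j * k j / Y" using k_square[of j] Y_nz by simp
    moreover have "sqrt ((\<beta>\<^sup>2 - (\<alpha> $ j)\<^sup>2) * Y) = k j" by (simp add: k_def kappa_def Y_def)
    ultimately show ?thesis using k_pos[of j] Y_nz by (simp add: field_simps)
  qed
  have "((\<lambda>y. sqrt ((\<beta>\<^sup>2 - (\<alpha> $ j)\<^sup>2) * Upsilon \<alpha> \<beta> b y)) has_derivative
      (\<lambda>v. (\<beta>\<^sup>2 - (\<alpha> $ j)\<^sup>2) * Y' v * (inverse (sqrt ((\<beta>\<^sup>2 - (\<alpha> $ j)\<^sup>2) * Y)) / 2))) (at x)"
    using pos[of j] by (auto intro!: derivative_eq_intros assms(2) simp: Y_def)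
  then show ?thesis unfolding eq by (simp add: kappa_def[abs_def] k_def Y_def)
qed

lemma S_map_differentiable:
  assumes "x \<in> U"
  shows "S_map \<alpha> \<beta> b differentiable (at x)"
proof -
  interpret branch_point \<alpha> \<beta> b x using branch_point[OF assms] .
  have [derivative_intros]: "(\<lambda>y. kappa \<alpha> \<beta> b y j) differentiable (at x)" for j
    using Upsilon_differentiable[OF assms] kappa_has_derivative[OF assms]
    unfolding differentiable_def by blast
  have nz: "kappa \<alpha> \<beta> b x j \<noteq> 0" for j using k_pos[of j] by (simp add: k_def)
  have "S_map \<alpha> \<beta> b = (\<lambda>y.
     (\<chi> j. ((Upsilon \<alpha> \<beta> b y - (\<alpha> $ j)\<^sup>2) * fst y $ j
      + \<alpha> $ j * a_coeff \<alpha> y * snd y $ j) / kappa \<alpha> \<beta> b y j,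
      \<chi> j. (\<alpha> $ j * b y * fst y $ j + \<beta>\<^sup>2 * snd y $ j) / kappa \<alpha> \<beta> b y j))"
    by (simp add: fun_eq_iff prod_eq_iff vec_eq_iff S_map_nth)
  moreover have "\<dots> differentiable (at x)"
    by (intro differentiable_Pair differentiable_vec_lambda derivative_intros nz
        Upsilon_differentiable b_differentiable a_coeff_differentiable d_nz assms)
  ultimately show ?thesis by simp
qed

text \<open>Allows an implicit relation between functions on the open set \<open>U\<close> to be
  differentiated.\<close>

lemma derivative_eq_on_U:
  assumes "x \<in> U" and "(f has_derivative f') (at x)" and "(g has_derivative g') (at x)"
    and "\<And>y. y \<in> U \<Longrightarrow> f y = g y"
  shows "f' v = g' v"
  using has_derivative_transform_within_open[OF assms(2) open_U assms(1,4)] assms(3)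
    has_derivative_unique by metis

text \<open>The derivative of the map is never computed explicitly: once it exists, differentiating
  \<open>kQ\<close>, \<open>beta_P\<close> and the two constraints yields the linear relations that
  \<open>wedge_identity\<close> needs.\<close>

lemma symplectic: "symplectic_on U (S_map \<alpha> \<beta> b)"
  unfolding symplectic_on_def
proof (intro ballI conjI allI)
  fix x assume x: "x \<in> U"
  show "S_map \<alpha> \<beta> b differentiable (at x)" by (rule S_map_differentiable[OF x])
  then obtain S' where S': "(S_map \<alpha> \<beta> b has_derivative S') (at x)" unfolding differentiable_def by blast
  obtain b' where b': "(b has_derivative b') (at x)"
    using b_differentiable[OF x] unfolding differentiable_def by blast
  obtain a' where a': "(a_coeff \<alpha> has_derivative a') (at x)"
    using a_coeff_differentiable branch_point.d_nz[OF branch_point[OF x]] unfolding differentiable_def by blast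
  obtain Y' where Y': "(Upsilon \<alpha> \<beta> b has_derivative Y') (at x)"
    using Upsilon_differentiable[OF x] unfolding differentiable_def by blast
  interpret branch_point \<alpha> \<beta> b x using branch_point[OF x] .
  note comp = bounded_linear.has_derivative[OF bounded_linear_vec_nth]
    has_derivative_fst has_derivative_snd
  have p': "((\<lambda>y. fst y $ j) has_derivative (\<lambda>v. fst v $ j)) (at x)"
    and q': "((\<lambda>y. snd y $ j) has_derivative (\<lambda>v. snd v $ j)) (at x)"
    and P': "((\<lambda>y. fst (S_map \<alpha> \<beta> b y) $ j) has_derivative (\<lambda>v. fst (S' v) $ j)) (at x)"
    and Q': "((\<lambda>y. snd (S_map \<alpha> \<beta> b y) $ j) has_derivative (\<lambda>v. snd (S' v) $ j)) (at x)" for j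
    by (rule comp comp[OF comp(2)] S' has_derivative_ident)+
  define k' where "k' v j = k j * Y' v / (2 * Y)" for v j
  have k': "((\<lambda>y. kappa \<alpha> \<beta> b y j) has_derivative (\<lambda>v. k' v j)) (at x)" for j
    using kappa_has_derivative[OF x Y', of j] by (simp add: k'_def k_def Y_def)
  define d' where "d' v = (\<Sum>j\<in>UNIV. p j * snd v $ j + q j * fst v $ j)" for v
  have d': "((\<lambda>y. 1 + fst y \<bullet> snd y) has_derivative d') (at x)"
  proof -
    have "((\<lambda>y. 1 + fst y \<bullet> snd y) has_derivative (\<lambda>v. fst x \<bullet> snd v + fst v \<bullet> snd x)) (at x)"
      by (auto intro!: derivative_eq_intros)
    then show ?thesis
      by (simp add: d'_def[abs_def] p_def q_def inner_vec_def sum.distrib mult.commute)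
  qed
  have dQ: "k' v j * Q j + k j * snd (S' v) $ j = \<alpha> $ j * b' v * p j + \<alpha> $ j * b x * fst v $ j + \<beta>\<^sup>2 * snd v $ j" for v j
  proof -
    have "k j * snd (S' v) $ j + k' v j * Q j = \<alpha> $ j * (b x * fst v $ j + b' v * p j) + \<beta>\<^sup>2 * snd v $ j"
    proof (rule derivative_eq_on_U[OF x, where v = v])
      show "((\<lambda>y. kappa \<alpha> \<beta> b y j * snd (S_map \<alpha> \<beta> b y) $ j) has_derivative
          (\<lambda>v. k j * snd (S' v) $ j + k' v j * Q j)) (at x)"
        unfolding k_def Q_def by (intro has_derivative_mult k' Q')
      show "((\<lambda>y. \<alpha> $ j * (b y * fst y $ j) + \<beta>\<^sup>2 * snd y $ j) has_derivative
          (\<lambda>v. \<alpha> $ j * (b x * fst v $ j + b' v * p j) + \<beta>\<^sup>2 * snd v $ j)) (at x)"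
        unfolding p_def by (intro has_derivative_add has_derivative_mult_right has_derivative_mult b' p' q')
    next
      fix y assume "y \<in> U"
      then interpret y: branch_point \<alpha> \<beta> b y by (rule branch_point)
      show "kappa \<alpha> \<beta> b y j * snd (S_map \<alpha> \<beta> b y) $ j = \<alpha> $ j * (b y * fst y $ j) + \<beta>\<^sup>2 * snd y $ j"
        using y.kQ[of j] by (simp add: y.k_def y.Q_def y.p_def y.q_def mult.assoc)
    qed
    then show ?thesis by (simp add: algebra_simps)
  qed
  have dP: "\<beta>\<^sup>2 * fst (S' v) $ j = k' v j * p j + k j * fst v $ j + \<alpha> $ j * a' v * Q j + \<alpha> $ j * a * snd (S' v) $ j" for v j
  proof -
    have "\<beta>\<^sup>2 * fst (S' v) $ j = (k j * fst v $ j + k' v j * p j) + \<alpha> $ j * (a * snd (S' v) $ j + a' v * Q j)"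
    proof (rule derivative_eq_on_U[OF x, where v = v])
      show "((\<lambda>y. \<beta>\<^sup>2 * fst (S_map \<alpha> \<beta> b y) $ j) has_derivative (\<lambda>v. \<beta>\<^sup>2 * fst (S' v) $ j)) (at x)"
        by (intro has_derivative_mult_right P')
      show "((\<lambda>y. kappa \<alpha> \<beta> b y j * fst y $ j + \<alpha> $ j * (a_coeff \<alpha> y * snd (S_map \<alpha> \<beta> b y) $ j)) has_derivative
          (\<lambda>v. (k j * fst v $ j + k' v j * p j) + \<alpha> $ j * (a * snd (S' v) $ j + a' v * Q j))) (at x)"
        unfolding p_def k_def a_def Q_def
        by (intro has_derivative_add has_derivative_mult_right has_derivative_mult a' p' k' Q')
    next
      fix y assume "y \<in> U"
      then interpret y: branch_point \<alpha> \<beta> b y by (rule branch_point)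
      show "\<beta>\<^sup>2 * fst (S_map \<alpha> \<beta> b y) $ j
          = kappa \<alpha> \<beta> b y j * fst y $ j + \<alpha> $ j * (a_coeff \<alpha> y * snd (S_map \<alpha> \<beta> b y) $ j)"
        using y.beta_P[of j] by (simp add: y.k_def y.Q_def y.P_def y.p_def y.a_def mult.assoc)
    qed
    then show ?thesis by (simp add: algebra_simps)
  qed
  have dY: "Y' v = a' v * b x + a * b' v" for v
  proof -
    have "((\<lambda>y. \<beta>\<^sup>2 + a_coeff \<alpha> y * b y) has_derivative (\<lambda>v. 0 + (a * b' v + a' v * b x))) (at x)"
      unfolding a_def by (intro has_derivative_add has_derivative_const has_derivative_mult a' b')
    then show ?thesis
      using derivative_eq_on_U[OF x Y', of _ _ v] by (simp add: Upsilon_def)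
  qed
  have quadsum: "((\<lambda>y. \<Sum>j\<in>UNIV. \<alpha> $ j * (f y j * f y j)) has_derivative
      (\<lambda>v. 2 * (\<Sum>j\<in>UNIV. \<alpha> $ j * (f x j * f' v j)))) (at x)"
    if "\<And>j. ((\<lambda>y. f y j) has_derivative (\<lambda>v. f' v j)) (at x)"
    for f and f' :: "'n phase \<Rightarrow> 'n \<Rightarrow> real"
  proof -
    have "((\<lambda>y. \<Sum>j\<in>UNIV. \<alpha> $ j * (f y j * f y j)) has_derivative
      (\<lambda>v. \<Sum>j\<in>UNIV. \<alpha> $ j * (f x j * f' v j + f' v j * f x j))) (at x)"
      by (intro has_derivative_sum has_derivative_mult_right has_derivative_mult that)
    then show ?thesis by (simp add: sum_distrib_left algebra_simps flip: sum.distrib)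
  qed
  have dcp: "2 * (\<Sum>j\<in>UNIV. \<alpha> $ j * (p j * fst v $ j)) = a' v * d + a * d' v" for v
  proof -
    have "2 * (\<Sum>j\<in>UNIV. \<alpha> $ j * (p j * fst v $ j)) = a * d' v + a' v * d"
    proof (rule derivative_eq_on_U[OF x, where v = v])
      show "((\<lambda>y. \<Sum>j\<in>UNIV. \<alpha> $ j * (fst y $ j * fst y $ j)) has_derivative
          (\<lambda>v. 2 * (\<Sum>j\<in>UNIV. \<alpha> $ j * (p j * fst v $ j)))) (at x)"
        unfolding p_def by (rule quadsum[OF p'])
      show "((\<lambda>y. a_coeff \<alpha> y * (1 + fst y \<bullet> snd y)) has_derivative (\<lambda>v. a * d' v + a' v * d)) (at x)"
        unfolding a_def d_def by (intro has_derivative_mult a' d')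
    next
      fix y assume "y \<in> U"
      then interpret y: branch_point \<alpha> \<beta> b y by (rule branch_point)
      show "(\<Sum>j\<in>UNIV. \<alpha> $ j * (fst y $ j * fst y $ j)) = a_coeff \<alpha> y * (1 + fst y \<bullet> snd y)"
        using y.constraint_a by (simp add: y.up_def Apow_inner y.a_def y.d_def)
    qed
    then show ?thesis by simp
  qed
  have dcQ: "2 * (\<Sum>j\<in>UNIV. \<alpha> $ j * (Q j * snd (S' v) $ j)) = - (b' v * d + b x * d' v)" for v
  proof -
    have "2 * (\<Sum>j\<in>UNIV. \<alpha> $ j * (Q j * snd (S' v) $ j)) = - (b x * d' v + b' v * d)"
    proof (rule derivative_eq_on_U[OF x, where v = v])
      show "((\<lambda>y. \<Sum>j\<in>UNIV. \<alpha> $ j * (snd (S_map \<alpha> \<beta> b y) $ j * snd (S_map \<alpha> \<beta> b y) $ j)) has_derivative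
          (\<lambda>v. 2 * (\<Sum>j\<in>UNIV. \<alpha> $ j * (Q j * snd (S' v) $ j)))) (at x)"
        unfolding Q_def by (rule quadsum[OF Q'])
      show "((\<lambda>y. - (b y * (1 + fst y \<bullet> snd y))) has_derivative (\<lambda>v. - (b x * d' v + b' v * d))) (at x)"
        unfolding d_def by (intro has_derivative_minus has_derivative_mult b' d')
    next
      fix y assume "y \<in> U"
      then interpret y: branch_point \<alpha> \<beta> b y by (rule branch_point)
      show "(\<Sum>j\<in>UNIV. \<alpha> $ j * (snd (S_map \<alpha> \<beta> b y) $ j * snd (S_map \<alpha> \<beta> b y) $ j)) = - (b y * (1 + fst y \<bullet> snd y))"
        using y.constraint_b by (simp add: y.Wq_def Apow_inner y.d_def)
    qed
    then show ?thesis by simp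
  qed
  have cp: "(\<Sum>j\<in>UNIV. \<alpha> $ j * (p j * p j)) = a * d"
    using constraint_a by (simp add: up_def Apow_inner p_def)
  fix u v
  have "omega (S' u) (S' v) = omega u v"
    unfolding omega_def
    \<comment> \<open>Each differentiated relation is supplied twice, for the tangent vectors u and
      v.\<close>
    by (rule wedge_identity[OF beta Y_eq Y_nz kQ cp dQ dQ dP dP k'_def k'_def dY dY d'_def d'_def dcp dcp dcQ dcQ])
  then show "omega (frechet_derivative (S_map \<alpha> \<beta> b) (at x) u) (frechet_derivative (S_map \<alpha> \<beta> b) (at x) v) = omega u v"
    by (simp flip: frechet_derivative_at[OF S'])
qed

end

section \<open>Assembly of symplecticity, invariance, involution and independence\<close>

theorem proposition2p1:
  fixes \<alpha> :: "real ^ 'n" and \<beta> :: real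
    and U :: "'n phase set" and b :: "'n phase \<Rightarrow> real"
  assumes "\<And>j. (\<alpha> $ j)\<^sup>2 \<noteq> 0"
    and "inj (\<lambda>j. (\<alpha> $ j)\<^sup>2)"
    and "\<beta> \<noteq> 0"
    and "breve_b_branch \<alpha> \<beta> U b"
  shows "symplectic_on U (S_map \<alpha> \<beta> b) \<and>
         Liouville_integrable_on U (S_map \<alpha> \<beta> b) (Finv \<alpha>)"
proof -
  interpret branch \<alpha> \<beta> U b using assms(3,4) by unfold_locales
  have "Finv \<alpha> k (S_map \<alpha> \<beta> b x) = Finv \<alpha> k x" if "x \<in> U" for k x
    using branch_point.Fgen_invariant[OF branch_point[OF that]] by (simp flip: Fgen_nth)
  then show ?thesis
    unfolding Liouville_integrable_on_def
    using symplectic poisson_Finv functionally_independent_Finv[OF assms(2)] by blast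
qed

end
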